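(* Let $\Delta^{n}$ be a ball centered at the origin $0$ in $\mathbb{C}^{n}$, let $F:\Delta^{n}\rightarrow\mathbb{C}^{n}$ be a holomorphic mapping such that $0$ is an isolated zero of $F$, and consider the system $$\dot{x}=\frac{dx}{dt}=F(x),\qquad x\in\Delta^{n},$$ with real time $t$. Then there is a complex analytic variety in $\Delta^{n}$ of pure complex dimension at least $1$ consisting of $0$ and periodic orbits of the system, all of the same period, if and only if the Jacobian matrix $F^{\prime}(0)$ has a nonzero pure imaginary eigenvalue, i.e. an eigenvalue $\omega i$ with $\omega\in\mathbb{R}$, $\omega\neq 0$.
   Context: Time $t$ is real. A periodic orbit is a nonconstant periodic orbit, and the period of a periodic orbit always means its least positive period. "Complex analytic variety in $\Delta^{n}$" is understood locally: an analytic subset of some open neighborhood of $0$ contained in $\Delta^{n}$. "Pure dimension" means that the variety has the same complex dimension at every one of its points. "Consisting of $0$ and periodic orbits of the same period" means that the variety contains $0$ and that its complement of $\{0\}$ is a union of (entire) periodic orbits, all having one common least positive period. *)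

theory Defs
  imports "HOL-Analysis.Analysis"
begin

text \<open>Holomorphy in several variables on an open set: the (real) Frechet derivative exists and is
  complex linear.\<close>

definition holomorphic_fun :: "(complex ^ 'n::finite) set \<Rightarrow> (complex ^ 'n \<Rightarrow> complex) \<Rightarrow> bool" where
  "holomorphic_fun S f \<longleftrightarrow>
     (\<forall>x\<in>S. \<exists>D. (f has_derivative D) (at x within S) \<and> (\<forall>c v. D (c *s v) = c * D v))"

definition holomorphic_map ::
    "(complex ^ 'n::finite) set \<Rightarrow> (complex ^ 'n \<Rightarrow> complex ^ 'm::finite) \<Rightarrow> bool" where
  "holomorphic_map S f \<longleftrightarrow> (\<forall>i. holomorphic_fun S (\<lambda>x. f x $ i))"

definition analytic_subset :: "(complex ^ 'n::finite) set \<Rightarrow> (complex ^ 'n) set \<Rightarrow> bool" where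
  "analytic_subset U A \<longleftrightarrow> A \<subseteq> U \<and>
     (\<forall>p\<in>U. \<exists>V fs. open V \<and> p \<in> V \<and> V \<subseteq> U \<and> finite fs \<and> (\<forall>f\<in>fs. holomorphic_fun V f) \<and>
        A \<inter> V = {x \<in> V. \<forall>f\<in>fs. f x = 0})"

text \<open>Near \<open>p\<close> the set \<open>A\<close> is a complex submanifold of complex dimension \<open>d\<close>: a biholomorphic
  chart \<open>\<phi>\<close> flattens it to a coordinate subspace with \<open>d\<close> free coordinates.\<close>

definition regular_point :: "(complex ^ 'n::finite) set \<Rightarrow> nat \<Rightarrow> complex ^ 'n \<Rightarrow> bool" where
  "regular_point A d p \<longleftrightarrow> p \<in> A \<and>
     (\<exists>V W \<phi> \<psi>. \<exists>I :: 'n set.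
        open V \<and> p \<in> V \<and> open W \<and> homeomorphism V W \<phi> \<psi> \<and>
        holomorphic_map V \<phi> \<and> holomorphic_map W \<psi> \<and> card I = d \<and>
        \<phi> ` (A \<inter> V) = {w \<in> W. \<forall>i. i \<notin> I \<longrightarrow> w $ i = 0})"

text \<open>The dimension of an analytic set at \<open>p\<close> is the upper limit of its dimensions at regular
  points tending to \<open>p\<close> (including \<open>p\<close> itself if it is regular), i.e. the largest \<open>d\<close> attained
  in every neighbourhood of \<open>p\<close>.  The set below is finite, and it is nonempty for \<open>p \<in> A\<close> with
  \<open>A\<close> analytic, because regular points are dense.\<close>

definition dim_at :: "(complex ^ 'n::finite) set \<Rightarrow> complex ^ 'n \<Rightarrow> nat" where
  "dim_at A p = Max {d. \<forall>N. open N \<and> p \<in> N \<longrightarrow> (\<exists>z\<in>N. regular_point A d z)}"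

definition pure_dimensional :: "(complex ^ 'n::finite) set \<Rightarrow> nat \<Rightarrow> bool" where
  "pure_dimensional A d \<longleftrightarrow> (\<forall>p\<in>A. dim_at A p = d)"

definition solution_on_line :: "('a::real_normed_vector \<Rightarrow> 'a) \<Rightarrow> 'a set \<Rightarrow> (real \<Rightarrow> 'a) \<Rightarrow> bool" where
  "solution_on_line F D x \<longleftrightarrow>
     (\<forall>t. x t \<in> D \<and> (x has_vector_derivative F (x t)) (at t))"

definition least_period :: "(real \<Rightarrow> 'a) \<Rightarrow> real \<Rightarrow> bool" where
  "least_period x T \<longleftrightarrow> 0 < T \<and> (\<forall>t. x (t + T) = x t) \<and>
     (\<forall>s. 0 < s \<and> s < T \<longrightarrow> \<not> (\<forall>t. x (t + s) = x t))"

definition periodic_orbit ::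
    "('a::real_normed_vector \<Rightarrow> 'a) \<Rightarrow> 'a set \<Rightarrow> real \<Rightarrow> 'a set \<Rightarrow> bool" where
  "periodic_orbit F D T C \<longleftrightarrow>
     (\<exists>x. solution_on_line F D x \<and> \<not> x constant_on UNIV \<and> least_period x T \<and> C = range x)"

definition consists_of_zero_and_isoperiodic_orbits ::
    "('a::real_normed_vector \<Rightarrow> 'a) \<Rightarrow> 'a set \<Rightarrow> 'a set \<Rightarrow> bool" where
  "consists_of_zero_and_isoperiodic_orbits F D A \<longleftrightarrow>
     0 \<in> A \<and> (\<exists>T. \<exists>\<C>. (\<forall>C\<in>\<C>. periodic_orbit F D T C) \<and> A - {0} = \<Union>\<C>)"

definition matrix_eigenvalue :: "'a::field ^ 'n ^ 'n::finite \<Rightarrow> 'a \<Rightarrow> bool" where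
  "matrix_eigenvalue M k \<longleftrightarrow> (\<exists>v. v \<noteq> 0 \<and> M *v v = k *s v)"

text \<open>For a holomorphic \<open>F\<close> the entry \<open>(i, j)\<close> of the library's \<open>jacobian F (at p)\<close>, taken at type
  \<^typ>\<open>complex ^ 'n ^ 'n\<close>, is the \<open>i\<close>-th component of the complex linear derivative applied to the
  \<open>j\<close>-th unit vector, i.e. the complex partial derivative of \<open>F\<^sub>i\<close> with respect to \<open>x\<^sub>j\<close>.\<close>

lemma holomorphic_map_jacobian:
  fixes F :: "complex ^ 'n::finite \<Rightarrow> complex ^ 'm::finite"
  assumes "open S" "holomorphic_map S F" "p \<in> S"
  shows "(F has_derivative (\<lambda>v. jacobian F (at p) *v v)) (at p)"
proof -
  have "\<forall>i. \<exists>D. ((\<lambda>x. F x $ i) has_derivative D) (at p within S) \<and>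
      (\<forall>c v. D (c *s v) = c * D v)"
    using assms(2,3) unfolding holomorphic_map_def holomorphic_fun_def by blast
  from choice[OF this] obtain D
    where D: "\<And>i. ((\<lambda>x. F x $ i) has_derivative D i) (at p)"
      and lin: "\<And>i c v. D i (c *s v) = c * D i v"
    unfolding at_within_open[OF assms(3,1)] by blast
  let ?D = "\<lambda>v. \<chi> i. D i v"
  have der: "(F has_derivative ?D) (at p)"
    by (subst has_derivative_componentwise_within)
       (auto simp: Basis_vec_def inner_axis intro!: has_derivative_inner_left D)
  have fd: "frechet_derivative F (at p) = ?D"
    by (rule frechet_derivative_at[OF der, symmetric])
  have expand: "D i v = (\<Sum>j\<in>UNIV. D i (axis j 1) * v $ j)" for i v
  proof -
    have "linear (D i)" using D has_derivative_linear by blast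
    then have "D i (\<Sum>j\<in>UNIV. v $ j *s axis j 1) = (\<Sum>j\<in>UNIV. D i (v $ j *s axis j 1))"
      by (rule linear_sum)
    then show ?thesis by (simp add: lin mult.commute basis_expansion)
  qed
  have "?D = (\<lambda>v. jacobian F (at p) *v v)"
    unfolding jacobian_def fd matrix_def matrix_vector_mult_def vec_lambda_beta
    by (subst expand) (rule refl)
  with der show ?thesis by simp
qed

end

theory Submission
  imports Defs "HOL-Complex_Analysis.Conformal_Mappings"
    "HOL-Computational_Algebra.Fundamental_Theorem_Algebra"
begin

text \<open>Suppose \<open>F'(0)\<close> has a nonzero imaginary eigenvalue. Among its positive integer multiples that
  are eigenvalues take the largest one, \<open>c = \<omega> \<i>\<close>, so that no \<open>k c\<close> with \<open>k \<ge> 2\<close> is an eigenvalue, and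
  let \<open>v\<close> be an eigenvector for \<open>c\<close>. The Briot--Bouquet equation \<open>c z h'(z) = F(h(z))\<close>, \<open>h(0) = 0\<close>,
  \<open>h'(0) = v\<close> then has a holomorphic solution: nonresonance gives approximate solutions to every order
  \<open>K\<close>, and once \<open>K\<close> is large compared with \<open>F'(0)\<close> Picard iteration contracts in the weighted norm
  \<open>sup |w(z)| / |z|^K\<close>. The image of a small disc under \<open>h\<close> is a graph over a coordinate axis,
  hence a smooth analytic curve, and it is filled by the orbits \<open>h(a exp(\<i> \<omega> t))\<close>, all of period
  \<open>2 \<pi> / |\<omega>|\<close>.

  Conversely, a variety of positive dimension does not have \<open>0\<close> as an isolated point, so there are arbitrarily
  small orbits \<open>x\<close> of a fixed least period \<open>T\<close>. The difference \<open>u(t) = x(t + T/2) - x(t)\<close> is nonzero,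
  satisfies \<open>u(t + T/2) = - u(t)\<close>, and solves \<open>u' = F'(0) u + r\<close> with \<open>|r| \<le> \<epsilon> |u|\<close>. If \<open>F'(0)\<close> had no
  nonzero imaginary eigenvalue, the linear operator would be invertible on antiperiodic
  functions and \<open>u\<close> would vanish.\<close>

section \<open>Holomorphic curves and maps\<close>

lemma norm_vector_smult_complex:
  fixes v :: "complex ^ 'n::finite"
  shows "norm (c *s v) = cmod c * norm v"
  by (simp add: norm_vec_def norm_mult L2_set_right_distrib)

lemma norm_le_card_mult_component:
  fixes x :: "complex ^ 'n::finite"
  assumes "\<And>i. cmod (x $ i) \<le> B"
  shows "norm x \<le> real CARD('n) * B"
proof -
  have "norm x \<le> (\<Sum>i\<in>UNIV. cmod (x $ i))"
    unfolding norm_vec_def by (rule L2_set_le_sum) simp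
  also have "\<dots> \<le> (\<Sum>i\<in>(UNIV::'n set). B)"
    by (rule sum_mono) (rule assms)
  finally show ?thesis by simp
qed

lemma bounded_linear_smult_left:
  "bounded_linear (\<lambda>c. c *s (v :: complex ^ 'n::finite))"
  by (rule bounded_linear_intro[where K = "norm v"])
    (auto simp: norm_vector_smult_complex vec_eq_iff algebra_simps)

lemma bounded_linear_matrix_vector_mult:
  "bounded_linear ((*v) (A :: complex ^ 'n::finite ^ 'm::finite))"
  by (rule linear_conv_bounded_linear[THEN iffD1]) simp

lemma norm_matrix_vector_mult_le:
  fixes A :: "complex ^ 'n::finite ^ 'm::finite"
  shows "norm (A *v x) \<le> onorm ((*v) A) * norm x"
  by (rule onorm[OF bounded_linear_matrix_vector_mult])

lemma matrix_vector_mult_smult: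
  fixes A :: "complex ^ 'n::finite ^ 'm::finite"
  shows "A *v (c *s x) = c *s (A *v x)"
  by (simp add: vector_scalar_commute)

lemma matrix_vector_mult_scaleR_complex:
  fixes A :: "complex ^ 'n::finite ^ 'm::finite"
  shows "A *v (c *\<^sub>R x) = c *\<^sub>R (A *v x)"
  by (rule linear_cmul[OF bounded_linear.linear[OF bounded_linear_matrix_vector_mult]])

lemma has_derivative_vec_iff:
  fixes f :: "'a::real_normed_vector \<Rightarrow> complex ^ 'n::finite"
  shows "(f has_derivative D) (at x within S) \<longleftrightarrow>
    (\<forall>i. ((\<lambda>x. f x $ i) has_derivative (\<lambda>v. D v $ i)) (at x within S))"
proof
  assume "(f has_derivative D) (at x within S)"
  then show "\<forall>i. ((\<lambda>x. f x $ i) has_derivative (\<lambda>v. D v $ i)) (at x within S)"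
    using bounded_linear.has_derivative[OF bounded_linear_vec_nth] by blast
next
  assume "\<forall>i. ((\<lambda>x. f x $ i) has_derivative (\<lambda>v. D v $ i)) (at x within S)"
  then show "(f has_derivative D) (at x within S)"
    by (subst has_derivative_componentwise_within)
      (auto simp: Basis_vec_def inner_axis intro!: has_derivative_inner_left)
qed

text \<open>Holomorphy is required coordinate by coordinate, so that the one-variable theory of
  \<open>holomorphic_on\<close> applies to each component.\<close>

definition holomorphic_curve :: "complex set \<Rightarrow> (complex \<Rightarrow> complex ^ 'n::finite) \<Rightarrow> bool" where
  "holomorphic_curve S f \<longleftrightarrow> (\<forall>i. (\<lambda>z. f z $ i) holomorphic_on S)"

definition curve_deriv :: "(complex \<Rightarrow> complex ^ 'n::finite) \<Rightarrow> complex \<Rightarrow> complex ^ 'n" where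
  "curve_deriv f z = (\<chi> i. deriv (\<lambda>z. f z $ i) z)"

text \<open>With the increment as the left factor, the derivative matches the components of
  \<open>c *s d\<close>, the form in which the derivative of a curve is written.\<close>

lemma has_field_derivative_iff_left:
  "(f has_field_derivative k) (at z) \<longleftrightarrow> (f has_derivative (\<lambda>c. c * k)) (at z)"
  by (simp add: has_field_derivative_def mult_commute_abs)

lemma holomorphic_curve_has_field_derivative:
  assumes "holomorphic_curve S f" "open S" "z \<in> S"
  shows "((\<lambda>z. f z $ i) has_field_derivative curve_deriv f z $ i) (at z)"
  using assms unfolding holomorphic_curve_def curve_deriv_def by (auto intro: holomorphic_derivI)

lemma holomorphic_curve_has_derivative:
  assumes "holomorphic_curve S f" "open S" "z \<in> S"
  shows "(f has_derivative (\<lambda>c. c *s curve_deriv f z)) (at z)"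
  unfolding has_derivative_vec_iff
  using holomorphic_curve_has_field_derivative[OF assms]
  by (simp add: has_field_derivative_iff_left)

lemma curve_derivI:
  assumes "\<And>i. ((\<lambda>z. f z $ i) has_field_derivative d $ i) (at z)"
  shows "curve_deriv f z = d"
  using assms by (simp add: curve_deriv_def vec_eq_iff DERIV_imp_deriv)

lemma holomorphic_curveI:
  assumes "\<And>z i. z \<in> S \<Longrightarrow> ((\<lambda>z. f z $ i) has_field_derivative d z $ i) (at z)"
  shows "holomorphic_curve S f"
  unfolding holomorphic_curve_def using assms
  by (auto simp: holomorphic_on_def field_differentiable_def intro: DERIV_subset)

lemma holomorphic_curve_subset: "holomorphic_curve S f \<Longrightarrow> T \<subseteq> S \<Longrightarrow> holomorphic_curve T f"
  unfolding holomorphic_curve_def by (blast intro: holomorphic_on_subset)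

lemma holomorphic_curve_curve_deriv: "holomorphic_curve S f \<Longrightarrow> open S \<Longrightarrow> holomorphic_curve S (curve_deriv f)"
  unfolding holomorphic_curve_def curve_deriv_def by (auto intro: holomorphic_deriv)

lemma holomorphic_curve_add: "holomorphic_curve S f \<Longrightarrow> holomorphic_curve S g \<Longrightarrow> holomorphic_curve S (\<lambda>z. f z + g z)"
  unfolding holomorphic_curve_def by (auto intro: holomorphic_intros)

lemma holomorphic_curve_diff: "holomorphic_curve S f \<Longrightarrow> holomorphic_curve S g \<Longrightarrow> holomorphic_curve S (\<lambda>z. f z - g z)"
  unfolding holomorphic_curve_def by (auto intro: holomorphic_intros)

lemma holomorphic_curve_smult: "c holomorphic_on S \<Longrightarrow> holomorphic_curve S g \<Longrightarrow> holomorphic_curve S (\<lambda>z. c z *s g z)"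
  unfolding holomorphic_curve_def by (auto intro: holomorphic_intros)

lemma holomorphic_curve_const: "holomorphic_curve S (\<lambda>z. v)"
  unfolding holomorphic_curve_def by (auto intro: holomorphic_intros)

lemma holomorphic_curve_continuous_on:
  assumes "holomorphic_curve S f"
  shows "continuous_on S f"
proof -
  have "continuous_on S (\<lambda>z. \<chi> i. f z $ i)"
    using assms unfolding holomorphic_curve_def
    by (intro continuous_on_vec_lambda holomorphic_on_imp_continuous_on) auto
  then show ?thesis by simp
qed

lemma curve_deriv_add:
  assumes "holomorphic_curve S f" "holomorphic_curve S g" "open S" "z \<in> S"
  shows "curve_deriv (\<lambda>z. f z + g z) z = curve_deriv f z + curve_deriv g z"
  by (rule curve_derivI) (auto intro!: derivative_eq_intros holomorphic_curve_has_field_derivative assms)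

lemma curve_deriv_diff:
  assumes "holomorphic_curve S f" "holomorphic_curve S g" "open S" "z \<in> S"
  shows "curve_deriv (\<lambda>z. f z - g z) z = curve_deriv f z - curve_deriv g z"
  by (rule curve_derivI) (auto intro!: derivative_eq_intros holomorphic_curve_has_field_derivative assms)

lemma curve_deriv_monom: "curve_deriv (\<lambda>z. z ^ k *s q) z = (of_nat k * z ^ (k - 1)) *s q"
  by (rule curve_derivI) (auto intro!: derivative_eq_intros)

lemma holomorphic_curve_monom: "holomorphic_curve S (\<lambda>z. z ^ k *s q)"
  unfolding holomorphic_curve_def by (auto intro!: holomorphic_intros)

lemma holomorphic_curve_compose:
  fixes F :: "complex ^ 'n::finite \<Rightarrow> complex ^ 'm::finite"
  assumes F: "holomorphic_map D F" "open D" and f: "holomorphic_curve S f" "open S" "f ` S \<subseteq> D"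
  shows "holomorphic_curve S (\<lambda>z. F (f z))"
proof (rule holomorphic_curveI)
  fix z i assume z: "z \<in> S"
  have "((\<lambda>x. F x) has_derivative (\<lambda>v. jacobian F (at (f z)) *v v)) (at (f z))"
    using holomorphic_map_jacobian[OF F(2,1)] z f(3) by blast
  from has_derivative_compose[OF holomorphic_curve_has_derivative[OF f(1,2) z] this]
  have "((\<lambda>z. F (f z)) has_derivative (\<lambda>c. c *s (jacobian F (at (f z)) *v curve_deriv f z))) (at z)"
    by (simp add: matrix_vector_mult_smult)
  then show "((\<lambda>z. F (f z) $ i) has_field_derivative (jacobian F (at (f z)) *v curve_deriv f z) $ i) (at z)"
    by (simp add: has_derivative_vec_iff has_field_derivative_iff_left)
qed

lemma holomorphic_map_continuous_on:
  assumes "holomorphic_map S f" "open S"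
  shows "continuous_on S f"
  using holomorphic_map_jacobian[OF assms(2,1)] assms(2)
  by (auto intro: continuous_at_imp_continuous_on has_derivative_continuous)

text \<open>Cauchy's estimate on complex lines upgrades differentiability at \<open>0\<close> to strict
  differentiability.\<close>

lemma holomorphic_map_strict_derivative:
  fixes F :: "complex ^ 'n::finite \<Rightarrow> complex ^ 'm::finite"
  assumes F: "holomorphic_map (ball 0 r) F" and r: "0 < r" and F0: "F 0 = 0" and \<epsilon>: "0 < \<epsilon>"
  defines "A \<equiv> jacobian F (at 0)"
  obtains \<delta> where "0 < \<delta>" "\<delta> \<le> r"
    "\<And>x y. x \<in> ball 0 \<delta> \<Longrightarrow> y \<in> ball 0 \<delta> \<Longrightarrow>
        norm (F x - F y - A *v (x - y)) \<le> \<epsilon> * norm (x - y)"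
proof -
  \<comment> \<open>The nonlinear remainder of \<open>F\<close> at 0. The mean value inequality
    turns a small bound on its derivative near 0 into the claim.\<close>
  define N where "N = (\<lambda>x. F x - A *v x)"
  \<comment> \<open>The 2 is the loss in Cauchy's estimate on a circle of radius \<open>s/2\<close>,
    where \<open>N\<close> is bounded by \<open>\<eta> * s\<close>; \<open>CARD('m)\<close> is the
    loss in passing from components to the norm.\<close>
  define \<eta> where "\<eta> = \<epsilon> / (2 * real CARD('m))"
  have \<eta>: "0 < \<eta>" using \<epsilon> by (simp add: \<eta>_def)
  have der: "(F has_derivative (\<lambda>v. A *v v)) (at 0)"
    unfolding A_def using holomorphic_map_jacobian[OF open_ball F] r by simp
  have "\<exists>d>0. \<forall>y. norm (y - 0) < d \<longrightarrow> norm (F y - F 0 - A *v (y - 0)) \<le> \<eta> * norm (y - 0)"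
    using der \<eta> unfolding has_derivative_at_alt by blast
  then obtain d where d: "0 < d"
    and Nd: "\<And>x. norm x < d \<Longrightarrow> norm (N x) \<le> \<eta> * norm x"
    unfolding N_def F0 by auto
  define s where "s = min d r"
  have s: "0 < s" "s \<le> d" "s \<le> r" using d r by (auto simp: s_def)
  have Nder: "(N has_derivative (\<lambda>v. jacobian F (at x) *v v - A *v v)) (at x)" if "x \<in> ball 0 s" for x
    unfolding N_def using holomorphic_map_jacobian[OF open_ball F, of x] that s
    by (auto intro!: derivative_intros bounded_linear_imp_has_derivative
        bounded_linear_matrix_vector_mult)
  have bound: "norm (jacobian F (at x) *v v - A *v v) \<le> \<epsilon> * norm v"
    if x: "x \<in> ball 0 (s/2)" and "norm v = 1" for x v
  proof -
    have in_ball: "x + \<zeta> *s v \<in> ball 0 s" if "cmod \<zeta> \<le> s/2" for \<zeta>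
      using norm_triangle_ineq[of x "\<zeta> *s v"] x that \<open>norm v = 1\<close>
      by (simp add: norm_vector_smult_complex)
    have *: "cmod ((jacobian F (at x) *v v - A *v v) $ i) \<le> 2 * \<eta>" for i
    proof -
      \<comment> \<open>Along the complex line through \<open>x\<close> in direction
        \<open>v\<close>, a component of \<open>N\<close> is holomorphic in one variable, and its
        derivative at 0 is the quantity to be bounded.\<close>
      define g where "g = (\<lambda>\<zeta>. N (x + \<zeta> *s v) $ i)"
      have gder: "(g has_field_derivative
          (jacobian F (at (x + \<zeta> *s v)) *v v - A *v v) $ i) (at \<zeta>)"
        if "cmod \<zeta> \<le> s/2" for \<zeta>
      proof -
        have "((\<lambda>\<zeta>. x + \<zeta> *s v) has_derivative (\<lambda>c. c *s v)) (at \<zeta>)"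
          by (auto intro!: derivative_eq_intros bounded_linear_imp_has_derivative
              bounded_linear_smult_left)
        from has_derivative_compose[OF this Nder[OF in_ball[OF that]]]
        have "((\<lambda>\<zeta>. N (x + \<zeta> *s v)) has_derivative
          (\<lambda>c. c *s (jacobian F (at (x + \<zeta> *s v)) *v v - A *v v))) (at \<zeta>)"
          by (simp add: matrix_vector_mult_smult vector_ssub_ldistrib)
        from this[unfolded has_derivative_vec_iff, rule_format, of i] show ?thesis unfolding g_def
          by (simp only: has_field_derivative_iff_left vector_smult_component)
      qed
      have hol: "g holomorphic_on ball 0 (s/2)"
        unfolding holomorphic_on_def field_differentiable_def
        using has_field_derivative_at_within[OF gder] by (metis less_imp_le mem_ball_0)
      have cont: "continuous_on (cball 0 (s/2)) g"
        using DERIV_isCont[OF gder] by (intro continuous_at_imp_continuous_on ballI) auto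
      have "norm ((deriv ^^ 1) g 0) \<le> fact 1 * (\<eta> * s) / (s/2) ^ 1"
      proof (rule Cauchy_inequality[OF hol cont])
        fix \<zeta> assume "norm (0 - \<zeta> :: complex) = s/2"
        then have xs: "x + \<zeta> *s v \<in> ball 0 s" using in_ball by simp
        have "cmod (g \<zeta>) \<le> norm (N (x + \<zeta> *s v))"
          unfolding g_def by (rule Finite_Cartesian_Product.norm_nth_le)
        also have "\<dots> \<le> \<eta> * norm (x + \<zeta> *s v)" using Nd xs s by auto
        also have "\<dots> \<le> \<eta> * s" using xs \<eta> by auto
        finally show "cmod (g \<zeta>) \<le> \<eta> * s" .
      qed (use s in auto)
      moreover have "deriv g 0 = (jacobian F (at x) *v v - A *v v) $ i"
        using gder[of 0] s by (simp add: DERIV_imp_deriv)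
      ultimately show ?thesis using s by simp
    qed
    have "norm (jacobian F (at x) *v v - A *v v) \<le> real CARD('m) * (2 * \<eta>)"
      by (rule norm_le_card_mult_component) (rule *)
    then show ?thesis using \<open>norm v = 1\<close> by (simp add: \<eta>_def)
  qed
  have bound': "norm (jacobian F (at x) *v v - A *v v) \<le> \<epsilon> * norm v"
    if x: "x \<in> ball 0 (s/2)" for x v
  proof (cases "v = 0")
    case False
    have "norm (jacobian F (at x) *v (v /\<^sub>R norm v) - A *v (v /\<^sub>R norm v))
        = norm (jacobian F (at x) *v v - A *v v) / norm v"
      by (simp add: matrix_vector_mult_scaleR_complex divide_inverse_commute flip: scaleR_diff_right)
    moreover have "norm (v /\<^sub>R norm v) = 1" using False by simp
    ultimately have "norm (jacobian F (at x) *v v - A *v v) / norm v \<le> \<epsilon>"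
      using bound[OF x, of "v /\<^sub>R norm v"] by (metis mult.right_neutral)
    then show ?thesis using False by (simp add: pos_divide_le_eq)
  qed simp
  have "norm (N x - N y) \<le> \<epsilon> * norm (x - y)" if "x \<in> ball 0 (s/2)" "y \<in> ball 0 (s/2)" for x y
  proof (rule differentiable_bound[OF convex_ball _ _ that])
    fix x :: "complex ^ 'n" assume x: "x \<in> ball 0 (s/2)"
    show "(N has_derivative (\<lambda>v. jacobian F (at x) *v v - A *v v)) (at x within ball 0 (s/2))"
      using Nder[of x] x s by (auto intro: has_derivative_at_withinI)
    show "onorm (\<lambda>v. jacobian F (at x) *v v - A *v v) \<le> \<epsilon>"
      by (rule onorm_le) (rule bound'[OF x])
  qed
  then have "norm (F x - F y - A *v (x - y)) \<le> \<epsilon> * norm (x - y)"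
    if "x \<in> ball 0 (s/2)" "y \<in> ball 0 (s/2)" for x y
    using that by (simp add: N_def matrix_vector_mult_diff_distrib algebra_simps)
  with that[of "s/2"] s show ?thesis by auto
qed

section \<open>The Briot--Bouquet equation\<close>

lemma scaleR_eq_smult_complex: "a *\<^sub>R (x :: complex ^ 'n) = complex_of_real a *s x"
  unfolding vec_eq_iff vector_scaleR_component vector_smult_component by (simp add: scaleR_conv_of_real)

lemma divide_add_one_mult_less:
  fixes e t n :: real
  assumes "0 < e" "0 < t" "0 \<le> n"
  shows "e / (n + 1) * (t * n) < t * e"
proof -
  have "e * t * n < e * t * (n + 1)" using assms by simp
  then show ?thesis using assms by (simp add: divide_less_eq mult_ac)
qed

text \<open>The difference quotient at 0 has a removable singularity, filled by the
  derivative.\<close>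

lemma holomorphic_curve_factor:
  assumes "holomorphic_curve (ball 0 \<rho>) f" "f 0 = 0"
  obtains g where "holomorphic_curve (ball 0 \<rho>) g" "\<And>z. z \<in> ball 0 \<rho> \<Longrightarrow> f z = z *s g z"
proof
  show "holomorphic_curve (ball 0 \<rho>) (\<lambda>z. \<chi> i. if z = 0 then deriv (\<lambda>z. f z $ i) 0 else (f z $ i - f 0 $ i) / (z - 0))"
    using assms(1) unfolding holomorphic_curve_def vec_lambda_beta by (blast intro: pole_lemma_open open_ball)
qed (simp add: vec_eq_iff assms(2))

lemma holomorphic_curve_limit_0:
  assumes "holomorphic_curve (ball 0 \<rho>) g" "0 < \<rho>" "(g \<longlongrightarrow> l) (at 0)"
  shows "g 0 = l"
proof -
  have "isCont g 0"
    using holomorphic_curve_continuous_on[OF assms(1)] assms(2)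
    by (simp add: continuous_on_eq_continuous_at)
  then show ?thesis using assms(3) by (simp add: isCont_def LIM_unique)
qed

text \<open>Orders of vanishing are integers, so o(z^k) already means divisible by z^(k+1). In the
  induction step the quotient by z^(k+1) tends to 0, hence vanishes at 0, and one more z splits
  off.\<close>

lemma holomorphic_curve_factor_power:
  assumes "holomorphic_curve (ball 0 \<rho>) f" "0 < \<rho>" "((\<lambda>z. inverse (z ^ k) *s f z) \<longlongrightarrow> 0) (at 0)"
  shows "\<exists>g. holomorphic_curve (ball 0 \<rho>) g \<and> (\<forall>z\<in>ball 0 \<rho>. f z = z ^ Suc k *s g z)"
  using assms
proof (induction k)
  case 0
  then have "f 0 = 0" by (intro holomorphic_curve_limit_0) auto
  from holomorphic_curve_factor[OF 0(1) this] obtain g where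
    "holomorphic_curve (ball 0 \<rho>) g" "\<And>z. z \<in> ball 0 \<rho> \<Longrightarrow> f z = z *s g z" by blast
  then show ?case by auto
next
  case (Suc k)
  have *: "((\<lambda>z. norm z * norm (inverse (z ^ Suc k) *s f z)) \<longlongrightarrow> 0) (at 0)"
    by (rule tendsto_eq_intros tendsto_norm_zero Suc.prems(3) tendsto_ident_at)+ simp
  have "((\<lambda>z. norm (inverse (z ^ k) *s f z)) \<longlongrightarrow> 0) (at 0)"
    by (rule Lim_transform_within[OF * zero_less_one])
      (auto simp: norm_vector_smult_complex norm_mult norm_inverse norm_power)
  then have "((\<lambda>z. inverse (z ^ k) *s f z) \<longlongrightarrow> 0) (at 0)"
    by (rule tendsto_norm_zero_cancel)
  from Suc.IH[OF Suc.prems(1,2) this] obtain g where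
    g: "holomorphic_curve (ball 0 \<rho>) g" "\<And>z. z \<in> ball 0 \<rho> \<Longrightarrow> f z = z ^ Suc k *s g z" by blast
  have "(g \<longlongrightarrow> 0) (at 0)"
  proof (rule Lim_transform_within[OF Suc.prems(3) \<open>0 < \<rho>\<close>])
    fix z :: complex assume z: "0 < dist z 0" "dist z 0 < \<rho>"
    then have "f z = z ^ Suc k *s g z" by (intro g) auto
    then show "inverse (z ^ Suc k) *s f z = g z"
      using z by (simp add: vector_smult_assoc del: power_Suc)
  qed
  then have "g 0 = 0" by (rule holomorphic_curve_limit_0[OF g(1) \<open>0 < \<rho>\<close>])
  from holomorphic_curve_factor[OF g(1) this] obtain g' where "holomorphic_curve (ball 0 \<rho>) g'"
    "\<And>z. z \<in> ball 0 \<rho> \<Longrightarrow> g z = z *s g' z" by blast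
  then show ?case using g by (intro exI[of _ g']) (auto simp: vector_smult_assoc mult_ac)
qed

lemma holomorphic_curve_shrink:
  assumes "holomorphic_curve (ball 0 \<rho>) f" "0 < \<rho>" "f 0 = 0" "0 < \<delta>"
  obtains \<rho>' where "0 < \<rho>'" "\<rho>' \<le> \<rho>" "\<And>z. z \<in> ball 0 \<rho>' \<Longrightarrow> norm (f z) < \<delta>"
proof -
  have "isCont f 0"
    using holomorphic_curve_continuous_on[OF assms(1)] assms(2)
    by (simp add: continuous_on_eq_continuous_at)
  then obtain d where "d > 0" "\<And>z. dist z 0 < d \<Longrightarrow> dist (f z) (f 0) < \<delta>"
    unfolding continuous_at_eps_delta using \<open>0 < \<delta>\<close> by blast
  then show ?thesis using assms by (intro that[of "min d \<rho>"]) auto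
qed

text \<open>Integrating t^(K-1) along the segment from 0 to \<open>z\<close> gains the factor 1/K.
  For large \<open>K\<close> this gain makes the Picard iteration contract.\<close>

lemma holomorphic_curve_norm_le_of_curve_deriv:
  assumes W: "holomorphic_curve (ball 0 \<rho>) W" "W 0 = 0" and "c \<noteq> 0" "1 \<le> K"
    and bound: "\<And>z. z \<in> ball 0 \<rho> \<Longrightarrow> norm ((c * z) *s curve_deriv W z) \<le> C * cmod z ^ K"
    and z: "z \<in> ball 0 \<rho>"
  shows "norm (W z) \<le> C / (cmod c * real K) * cmod z ^ K"
proof -
  \<comment> \<open>On the segment the derivative is at most D t^(K-1), with primitive D t^K /
    K.\<close>
  define D where "D = C * cmod z ^ K / cmod c"
  have tz: "of_real t * z \<in> ball 0 \<rho>" if "0 \<le> t" "t \<le> 1" for t :: real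
    using z that by (simp add: norm_mult) (smt (verit) mult_left_le_one_le norm_ge_zero)
  have der: "((\<lambda>t. W (of_real t * z)) has_vector_derivative z *s curve_deriv W (of_real t * z)) (at t)"
    if "0 \<le> t" "t \<le> 1" for t
  proof -
    have "((\<lambda>t. of_real t * z) has_derivative (\<lambda>s. of_real s * z)) (at t)"
      by (auto intro!: derivative_eq_intros)
    from has_derivative_compose[OF this holomorphic_curve_has_derivative[OF W(1) open_ball tz[OF that]]]
    show ?thesis
      by (auto simp: has_vector_derivative_def scaleR_eq_smult_complex
          vector_smult_assoc elim!: back_subst[of "\<lambda>D. (_ has_derivative D) _"])
  qed
  have "norm (W (of_real 1 * z) - W (of_real 0 * z)) \<le> D / real K * 1 ^ K - D / real K * 0 ^ K"
  proof (rule differentiable_bound_general[where \<phi> = "\<lambda>t. D / real K * t ^ K"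
        and \<phi>' = "\<lambda>t. D * t ^ (K - 1)" and f' = "\<lambda>t. z *s curve_deriv W (of_real t * z)"])
    show "continuous_on {0..1} (\<lambda>t. W (of_real t * z))"
      using has_vector_derivative_continuous[OF der]
      by (intro continuous_at_imp_continuous_on) auto
    show "continuous_on {0..1} (\<lambda>t. D / real K * t ^ K)" by (intro continuous_intros)
    fix t :: real assume t: "0 < t" "t < 1"
    show "((\<lambda>t. W (of_real t * z)) has_vector_derivative z *s curve_deriv W (of_real t * z)) (at t)"
      using der t by simp
    show "((\<lambda>t. D / real K * t ^ K) has_vector_derivative D * t ^ (K - 1)) (at t)"
      using \<open>1 \<le> K\<close> unfolding has_real_derivative_iff_has_vector_derivative[symmetric]
      by (auto intro!: derivative_eq_intros)
    have "cmod c * t * norm (z *s curve_deriv W (of_real t * z)) \<le> C * (t ^ K * cmod z ^ K)"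
      using bound[OF tz[of t]] t
      by (simp add: norm_vector_smult_complex norm_mult power_mult_distrib mult_ac)
    also have "t ^ K = t * t ^ (K - 1)" using \<open>1 \<le> K\<close> by (simp add: power_eq_if)
    finally show "norm (z *s curve_deriv W (of_real t * z)) \<le> D * t ^ (K - 1)"
      using t \<open>c \<noteq> 0\<close> by (simp add: D_def field_simps)
  qed simp
  then show ?thesis using \<open>1 \<le> K\<close> W(2) by (simp add: D_def zero_power)
qed

text \<open>Since \<open>g\<close> vanishes at 0, it can be divided by z; the quotient has a
  primitive on the disc, which is normalised to vanish at 0.\<close>

lemma holomorphic_curve_solve_curve_deriv:
  assumes g: "holomorphic_curve (ball 0 \<rho>) g" and "g 0 = 0" "c \<noteq> 0" "0 < \<rho>"
  obtains W where "holomorphic_curve (ball 0 \<rho>) W" "W 0 = 0" "\<And>z. z \<in> ball 0 \<rho> \<Longrightarrow> (c * z) *s curve_deriv W z = g z"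
proof -
  obtain a where a: "holomorphic_curve (ball 0 \<rho>) a" and ga: "\<And>z. z \<in> ball 0 \<rho> \<Longrightarrow> g z = z *s a z"
    using holomorphic_curve_factor[OF g \<open>g 0 = 0\<close>] by blast
  have "\<exists>u. \<forall>z\<in>ball 0 \<rho>. (u has_field_derivative a z $ i) (at z)" for i
    using holomorphic_convex_primitive'[of "ball 0 \<rho>" "\<lambda>z. a z $ i"] a
    unfolding holomorphic_curve_def by (metis at_within_open convex_ball open_ball)
  then obtain u where u: "\<And>i z. z \<in> ball 0 \<rho> \<Longrightarrow> (u i has_field_derivative a z $ i) (at z)"
    by metis
  define W where "W = (\<lambda>z. \<chi> i. (u i z - u i 0) / c)"
  have der: "((\<lambda>z. W z $ i) has_field_derivative (inverse c *s a z) $ i) (at z)"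
    if "z \<in> ball 0 \<rho>" for i z
    unfolding W_def using u[OF that] \<open>c \<noteq> 0\<close>
    by (auto intro!: derivative_eq_intros simp: field_simps)
  show ?thesis
  proof
    show "holomorphic_curve (ball 0 \<rho>) W" by (rule holomorphic_curveI) (rule der)
    show "W 0 = 0" by (simp add: W_def vec_eq_iff)
    show "(c * z) *s curve_deriv W z = g z" if "z \<in> ball 0 \<rho>" for z
      using curve_derivI[OF der[OF that]] ga[OF that] \<open>c \<noteq> 0\<close> by (simp add: vector_smult_assoc)
  qed
qed

section \<open>Approximate solutions of every order\<close>

lemma formal_solution:
  fixes F :: "complex ^ 'n::finite \<Rightarrow> complex ^ 'n"
  assumes F: "holomorphic_map (ball 0 r) F" "0 < r" "F 0 = 0"
    and v: "jacobian F (at 0) *v v = c *s v"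
    and nonres: "\<forall>k::nat. 2 \<le> k \<longrightarrow> (\<forall>x. jacobian F (at 0) *v x = (of_nat k * c) *s x \<longrightarrow> x = 0)"
    and "1 \<le> k"
  shows "\<exists>\<rho> p. 0 < \<rho> \<and> holomorphic_curve (ball 0 \<rho>) p \<and> p 0 = 0 \<and> curve_deriv p 0 = v \<and> p ` ball 0 \<rho> \<subseteq> ball 0 r \<and>
    ((\<lambda>z. inverse (z ^ k) *s ((c * z) *s curve_deriv p z - F (p z))) \<longlongrightarrow> 0) (at 0)"
  using \<open>1 \<le> k\<close>
proof (induction k rule: dec_induct)
  case base
  define A where "A = jacobian F (at 0)"
  \<comment> \<open>Start from the linear approximation: up to sign its defect is the nonlinear part
    of \<open>F\<close> at z v, hence o(z).\<close>
  define p where "p = (\<lambda>z. z ^ 1 *s v)"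
  have vdp: "curve_deriv p z = v" for z unfolding p_def by (subst curve_deriv_monom) simp
  have p: "holomorphic_curve S p" for S unfolding p_def by (rule holomorphic_curve_monom)
  obtain \<rho> where \<rho>: "0 < \<rho>" "\<And>z. z \<in> ball 0 \<rho> \<Longrightarrow> norm (p z) < r"
    using holomorphic_curve_shrink[OF p zero_less_one _ \<open>0 < r\<close>] by (auto simp: p_def)
  have "((\<lambda>z. inverse (z ^ 1) *s ((c * z) *s curve_deriv p z - F (p z))) \<longlongrightarrow> 0) (at 0)"
  proof (rule tendstoI)
    fix e :: real assume e: "0 < e"
    have "0 < e / (norm v + 1)" using e by (simp add: add_nonneg_pos)
    from holomorphic_map_strict_derivative[OF F this] obtain \<delta> where \<delta>: "0 < \<delta>" "\<delta> \<le> r"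
      "\<And>x y. x \<in> ball 0 \<delta> \<Longrightarrow> y \<in> ball 0 \<delta> \<Longrightarrow>
        norm (F x - F y - A *v (x - y)) \<le> e / (norm v + 1) * norm (x - y)"
      unfolding A_def by blast
    obtain \<rho>' where \<rho>': "0 < \<rho>'" "\<And>z. z \<in> ball 0 \<rho>' \<Longrightarrow> norm (p z) < \<delta>"
      using holomorphic_curve_shrink[OF p zero_less_one _ \<delta>(1)] by (auto simp: p_def)
    have "norm (inverse (z ^ 1) *s ((c * z) *s curve_deriv p z - F (p z))) < e"
      if "z \<noteq> 0" "z \<in> ball 0 \<rho>'" for z
    proof -
      have "norm ((c * z) *s curve_deriv p z - F (p z)) = norm (F (p z) - F 0 - A *v (p z - 0))"
        unfolding vdp using v by (simp add: F(3) A_def p_def matrix_vector_mult_smult vector_smult_assoc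
            mult.commute norm_minus_commute)
      also have "\<dots> \<le> e / (norm v + 1) * (cmod z * norm v)"
        using \<delta>(3)[of "p z" 0] \<rho>'(2)[OF that(2)] \<delta>(1)
        by (simp add: p_def norm_vector_smult_complex)
      also have "\<dots> < cmod z * e"
        using that e by (intro divide_add_one_mult_less) auto
      finally show ?thesis
        using that unfolding norm_vector_smult_complex by (simp add: norm_inverse norm_divide field_simps)
    qed
    then show "\<forall>\<^sub>F z in at 0. dist (inverse (z ^ 1) *s ((c * z) *s curve_deriv p z - F (p z))) 0 < e"
      using \<rho>'(1) unfolding eventually_at by (intro exI[of _ \<rho>']) auto
  qed
  moreover have "p 0 = 0" "curve_deriv p 0 = v" by (simp_all add: vdp) (simp add: p_def)
  moreover have "p ` ball 0 \<rho> \<subseteq> ball 0 r" using \<rho> by auto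
  ultimately show ?case using \<rho>(1) p by blast
next
  case (step k)
  define A where "A = jacobian F (at 0)"
  from step.IH obtain \<rho> p where \<rho>: "0 < \<rho>" and p: "holomorphic_curve (ball 0 \<rho>) p" "p 0 = 0" "curve_deriv p 0 = v"
    "p ` ball 0 \<rho> \<subseteq> ball 0 r"
    and lim: "((\<lambda>z. inverse (z ^ k) *s ((c * z) *s curve_deriv p z - F (p z))) \<longlongrightarrow> 0) (at 0)"
    by blast
  \<comment> \<open>Adding z^m q changes the coefficient of z^m in the defect c z p' - F(p) by (m c
    - A) q. Nonresonance makes this map invertible, because \<open>m\<close> is at least 2.\<close>
  define m where "m = Suc k"
  have m: "2 \<le> m" using step.hyps by (simp add: m_def)
  have "holomorphic_curve (ball 0 \<rho>) (\<lambda>z. (c * z) *s curve_deriv p z - F (p z))"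
    by (intro holomorphic_curve_diff holomorphic_curve_smult holomorphic_curve_curve_deriv holomorphic_curve_compose[OF F(1)] p open_ball holomorphic_intros)
  from holomorphic_curve_factor_power[OF this \<rho> lim] obtain \<gamma> where
    \<gamma>: "holomorphic_curve (ball 0 \<rho>) \<gamma>" "\<And>z. z \<in> ball 0 \<rho> \<Longrightarrow> (c * z) *s curve_deriv p z - F (p z) = z ^ m *s \<gamma> z"
    unfolding m_def by blast
  \<comment> \<open>\<open>q\<close> is chosen to cancel \<open>\<gamma> 0\<close>, the leading
    coefficient of the defect.\<close>
  obtain q where q: "A *v q - (of_nat m * c) *s q = \<gamma> 0"
  proof -
    define M where "M = A - mat (of_nat m * c)"
    have M: "M *v x = A *v x - (of_nat m * c) *s x" for x
      by (simp add: M_def matrix_vector_mult_diff_rdistrib)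
        (simp add: vec_eq_iff matrix_vector_mult_def mat_def if_distrib[of "\<lambda>x. x * _"] cong: if_cong)
    have "\<forall>x. M *v x = 0 \<longrightarrow> x = 0"
      using nonres m by (simp add: M A_def)
    then have "\<exists>B. M ** B = mat 1"
      using matrix_left_invertible_ker matrix_left_right_inverse by metis
    then have "surj ((*v) M)" unfolding matrix_right_invertible_surjective .
    then obtain q where "\<gamma> 0 = M *v q" by (metis surjD)
    then show ?thesis using that by (simp add: M)
  qed
  define w where "w = (\<lambda>z. z ^ m *s q)"
  define p1 where "p1 = (\<lambda>z. p z + w z)"
  have w: "holomorphic_curve S w" for S unfolding w_def by (rule holomorphic_curve_monom)
  have p1: "holomorphic_curve (ball 0 \<rho>) p1" unfolding p1_def by (intro holomorphic_curve_add p w)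
  have p10: "p1 0 = 0" using m by (simp add: p1_def w_def p(2))
  have vdp1: "curve_deriv p1 z = curve_deriv p z + (of_nat m * z ^ (m - 1)) *s q" if "z \<in> ball 0 \<rho>" for z
    unfolding p1_def using curve_deriv_add[OF p(1) w open_ball that] by (simp add: w_def curve_deriv_monom)
  have vdp10: "curve_deriv p1 0 = v" using vdp1[of 0] \<rho> p(3) m by (simp add: zero_power)
  \<comment> \<open>This is the new defect divided by z^m. The last term tends to 0 by strict
    differentiability, since \<open>p1\<close> and \<open>p\<close> differ by \<open>w\<close>, of
    size |z|^m, while \<open>p\<close> itself is only small.\<close>
  have "((\<lambda>z. \<gamma> z + (of_nat m * c) *s q - A *v q
      - inverse (z ^ m) *s (F (p1 z) - F (p z) - A *v w z)) \<longlongrightarrow>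
      \<gamma> 0 + (of_nat m * c) *s q - A *v q - 0) (at 0)"
  proof (intro tendsto_intros)
    have "isCont \<gamma> 0"
      using holomorphic_curve_continuous_on[OF \<gamma>(1)] \<rho> by (simp add: continuous_on_eq_continuous_at)
    then show "(\<gamma> \<longlongrightarrow> \<gamma> 0) (at 0)" by (simp add: isCont_def)
    show "((\<lambda>z. inverse (z ^ m) *s (F (p1 z) - F (p z) - A *v w z)) \<longlongrightarrow> 0) (at 0)"
    proof (rule tendstoI)
      fix e :: real assume e: "0 < e"
      have "0 < e / (norm q + 1)" using e by (simp add: add_nonneg_pos)
      from holomorphic_map_strict_derivative[OF F this] obtain \<delta> where \<delta>: "0 < \<delta>" "\<delta> \<le> r"
        "\<And>x y. x \<in> ball 0 \<delta> \<Longrightarrow> y \<in> ball 0 \<delta> \<Longrightarrow>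
          norm (F x - F y - A *v (x - y)) \<le> e / (norm q + 1) * norm (x - y)"
        unfolding A_def by blast
      obtain \<rho>1 where \<rho>1: "0 < \<rho>1" "\<And>z. z \<in> ball 0 \<rho>1 \<Longrightarrow> norm (p z) < \<delta>"
        using holomorphic_curve_shrink[OF p(1) \<rho> p(2) \<delta>(1)] by blast
      obtain \<rho>2 where \<rho>2: "0 < \<rho>2" "\<And>z. z \<in> ball 0 \<rho>2 \<Longrightarrow> norm (p1 z) < \<delta>"
        using holomorphic_curve_shrink[OF p1 \<rho> p10 \<delta>(1)] by blast
      have "norm (inverse (z ^ m) *s (F (p1 z) - F (p z) - A *v w z)) < e"
        if "z \<noteq> 0" "z \<in> ball 0 \<rho>1" "z \<in> ball 0 \<rho>2" for z
      proof -
        have "norm (F (p1 z) - F (p z) - A *v w z) \<le> e / (norm q + 1) * norm (w z)"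
          using \<delta>(3)[of "p1 z" "p z"] \<rho>1(2)[OF that(2)] \<rho>2(2)[OF that(3)] by (simp add: p1_def)
        also have "\<dots> = e / (norm q + 1) * (cmod z ^ m * norm q)"
          by (simp add: w_def norm_vector_smult_complex norm_power)
        also have "\<dots> < cmod z ^ m * e"
          using that e by (intro divide_add_one_mult_less) auto
        finally show ?thesis
          using that unfolding norm_vector_smult_complex
            by (simp add: norm_inverse norm_divide norm_power field_simps)
      qed
      then show "\<forall>\<^sub>F z in at 0. dist (inverse (z ^ m) *s (F (p1 z) - F (p z) - A *v w z)) 0 < e"
        using \<rho>1(1) \<rho>2(1) unfolding eventually_at by (intro exI[of _ "min \<rho>1 \<rho>2"]) auto
    qed
  qed
  then have lim1: "((\<lambda>z. inverse (z ^ m) *s ((c * z) *s curve_deriv p1 z - F (p1 z))) \<longlongrightarrow>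
      \<gamma> 0 + (of_nat m * c) *s q - A *v q) (at 0)"
    unfolding diff_0_right
  proof (rule Lim_transform_within[OF _ \<rho>])
    fix z :: complex assume z: "0 < dist z 0" "dist z 0 < \<rho>"
    then have zb: "z \<in> ball 0 \<rho>" by auto
    have zm: "z * z ^ (m - 1) = z ^ m" using m by (simp add: power_eq_if)
    have "(c * z) *s curve_deriv p1 z - F (p1 z)
      = ((c * z) *s curve_deriv p z - F (p z)) + (of_nat m * c * z ^ m) *s q - (F (p1 z) - F (p z))"
      by (simp add: vdp1[OF zb] vector_add_ldistrib vector_smult_assoc zm[symmetric] mult_ac)
    also have "\<dots> = z ^ m *s \<gamma> z + (of_nat m * c * z ^ m) *s q - A *v w z
        - (F (p1 z) - F (p z) - A *v w z)"
      by (simp add: \<gamma>(2)[OF zb])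
    also have "\<dots> = z ^ m *s (\<gamma> z + (of_nat m * c) *s q - A *v q)
        - (F (p1 z) - F (p z) - A *v w z)"
      by (simp add: w_def matrix_vector_mult_smult vector_add_ldistrib vector_ssub_ldistrib
          vector_smult_assoc mult_ac)
    finally show "\<gamma> z + (of_nat m * c) *s q - A *v q
        - inverse (z ^ m) *s (F (p1 z) - F (p z) - A *v w z)
        = inverse (z ^ m) *s ((c * z) *s curve_deriv p1 z - F (p1 z))"
      using z by (simp add: vector_ssub_ldistrib vector_smult_assoc)
  qed
  moreover have "\<gamma> 0 + (of_nat m * c) *s q - A *v q = 0" using q by (simp add: algebra_simps)
  moreover obtain \<rho>' where \<rho>': "0 < \<rho>'" "\<rho>' \<le> \<rho>" "\<And>z. z \<in> ball 0 \<rho>' \<Longrightarrow> norm (p1 z) < r"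
    using holomorphic_curve_shrink[OF p1 \<rho> p10 \<open>0 < r\<close>] by blast
  moreover have "holomorphic_curve (ball 0 \<rho>') p1" using p1 \<rho>'(2) by (auto elim!: holomorphic_curve_subset)
  moreover have "p1 ` ball 0 \<rho>' \<subseteq> ball 0 r" using \<rho>' by auto
  ultimately show ?case using p10 vdp10 unfolding m_def by auto
qed

section \<open>Convergence of the Picard iteration\<close>

lemma uniform_limit_of_geometric_steps:
  fixes w :: "nat \<Rightarrow> 'a \<Rightarrow> 'b::banach"
  assumes "\<And>n z. z \<in> S \<Longrightarrow> norm (w (Suc n) z - w n z) \<le> M * (1/2) ^ n"
  obtains l where "uniform_limit S w l sequentially"
proof -
  have "summable (\<lambda>n. M * (1/2::real) ^ n)"
    by (intro summable_mult summable_geometric) simp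
  with assms have "uniform_limit S (\<lambda>n z. \<Sum>i<n. w (Suc i) z - w i z)
      (\<lambda>z. \<Sum>i. w (Suc i) z - w i z) sequentially"
    by (intro Weierstrass_m_test)
  moreover have "(\<Sum>i<n. w (Suc i) z - w i z) = w n z - w 0 z" for n z
    by (induction n) auto
  ultimately have "uniform_limit S (\<lambda>n z. w n z - w 0 z) (\<lambda>z. \<Sum>i. w (Suc i) z - w i z) sequentially"
    by simp
  from uniform_limit_add[OF this uniform_limit_const[of "w 0"]]
  show ?thesis by (intro that) simp
qed

text \<open>Uniform limits of holomorphic functions commute with differentiation, so the limit of
  the iterates inherits the differential equation.\<close>

lemma holomorphic_curve_uniform_limit:
  assumes w: "\<And>n. holomorphic_curve (ball 0 \<rho>) (w n)" and lim: "uniform_limit (ball 0 \<rho>) w l sequentially"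
  shows "holomorphic_curve (ball 0 \<rho>) l"
    and "z \<in> ball 0 \<rho> \<Longrightarrow> (\<lambda>n. curve_deriv (w n) z) \<longlonglongrightarrow> curve_deriv l z"
proof -
  have lim': "uniform_limit (ball 0 \<rho>) (\<lambda>n z. w n z $ i) (\<lambda>z. l z $ i) sequentially" for i
    by (rule bounded_linear.uniform_limit[OF bounded_linear_vec_nth lim])
  show "holomorphic_curve (ball 0 \<rho>) l" unfolding holomorphic_curve_def
  proof (rule allI, rule holomorphic_uniform_sequence)
    fix i show "\<And>n. (\<lambda>z. w n z $ i) holomorphic_on ball 0 \<rho>" using w by (simp add: holomorphic_curve_def)
    fix x :: complex assume "x \<in> ball 0 \<rho>"
    then obtain d where "0 < d" "cball x d \<subseteq> ball 0 \<rho>" using open_contains_cball by blast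
    with lim'[of i] show "\<exists>d>0. cball x d \<subseteq> ball 0 \<rho> \<and>
        uniform_limit (cball x d) (\<lambda>n z. w n z $ i) (\<lambda>z. l z $ i) sequentially"
      by (blast intro: uniform_limit_on_subset)
  qed simp
  show "(\<lambda>n. curve_deriv (w n) z) \<longlonglongrightarrow> curve_deriv l z" if "z \<in> ball 0 \<rho>"
    unfolding curve_deriv_def
    by (intro tendsto_vec_lambda deriv_complex_uniform_limit[OF lim'] open_ball that)
      (use w in \<open>auto simp: holomorphic_curve_def\<close>)
qed

text \<open>The solution is sought as \<open>p\<close> plus a correction bounded by M |z|^K, where
  \<open>p\<close> is an approximate solution whose defect is divisible by z^K. Picard iteration for
  the correction is a contraction with factor 1/2 in the norm weighted by |z|^K.\<close>

lemma invariant_disc: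
  fixes F :: "complex ^ 'n::finite \<Rightarrow> complex ^ 'n"
  assumes F: "holomorphic_map (ball 0 r) F" "0 < r" "F 0 = 0"
    and v: "jacobian F (at 0) *v v = c *s v" and "c \<noteq> 0"
    and nonres: "\<forall>k::nat. 2 \<le> k \<longrightarrow> (\<forall>x. jacobian F (at 0) *v x = (of_nat k * c) *s x \<longrightarrow> x = 0)"
  obtains \<rho> h where "0 < \<rho>" "holomorphic_curve (ball 0 \<rho>) h" "h 0 = 0" "curve_deriv h 0 = v"
    "h ` ball 0 \<rho> \<subseteq> ball 0 r" "\<And>z. z \<in> ball 0 \<rho> \<Longrightarrow> (c * z) *s curve_deriv h z = F (h z)"
proof -
  define A where "A = jacobian F (at 0)"
  \<comment> \<open>A Lipschitz constant of \<open>F\<close> near 0; the added 1 is the tolerance in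
    \<open>strict\<close>.\<close>
  define L where "L = onorm ((*v) A) + 1"
  have "0 \<le> onorm ((*v) A)" by (rule onorm_pos_le[OF bounded_linear_matrix_vector_mult])
  then have L: "0 < L" by (simp add: L_def)
  obtain \<delta> where \<delta>: "0 < \<delta>" "\<delta> \<le> r" and strict: "\<And>x y. x \<in> ball 0 \<delta> \<Longrightarrow> y \<in> ball 0 \<delta> \<Longrightarrow>
      norm (F x - F y - A *v (x - y)) \<le> 1 * norm (x - y)"
    using holomorphic_map_strict_derivative[OF F zero_less_one] unfolding A_def by blast
  have lip: "norm (F x - F y) \<le> L * norm (x - y)" if "norm x < \<delta>" "norm y < \<delta>" for x y
    using strict[of x y] that norm_matrix_vector_mult_le[of A "x - y"]
      norm_triangle_sub[of "F x - F y" "A *v (x - y)"]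
    by (simp add: L_def distrib_right)
  \<comment> \<open>This makes L / (|c| K) at most 1/2.\<close>
  obtain K :: nat where "max 2 (2 * L / cmod c) \<le> real K" using real_arch_simple by blast
  then have K: "2 \<le> K" "2 * L \<le> cmod c * real K"
    using \<open>c \<noteq> 0\<close> by (auto simp: pos_divide_le_eq mult.commute)
  have cK: "0 < cmod c * real K" using K \<open>c \<noteq> 0\<close> by simp
  \<comment> \<open>Order \<open>K - 1\<close> is enough: a defect o(z^(K-1)) is divisible by
    z^K.\<close>
  have "1 \<le> K - 1" using K by simp
  from formal_solution[OF F v nonres this] obtain \<rho>0 p where \<rho>0: "0 < \<rho>0"
    and p: "holomorphic_curve (ball 0 \<rho>0) p" "p 0 = 0" "curve_deriv p 0 = v" "p ` ball 0 \<rho>0 \<subseteq> ball 0 r"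
    and lim: "((\<lambda>z. inverse (z ^ (K - 1)) *s ((c * z) *s curve_deriv p z - F (p z))) \<longlongrightarrow> 0) (at 0)"
    by blast
  have "holomorphic_curve (ball 0 \<rho>0) (\<lambda>z. (c * z) *s curve_deriv p z - F (p z))"
    by (intro holomorphic_curve_diff holomorphic_curve_smult holomorphic_curve_curve_deriv holomorphic_curve_compose[OF F(1)] p open_ball holomorphic_intros)
  from holomorphic_curve_factor_power[OF this \<rho>0 lim] obtain \<gamma> where
    \<gamma>: "holomorphic_curve (ball 0 \<rho>0) \<gamma>" "\<And>z. z \<in> ball 0 \<rho>0 \<Longrightarrow> (c * z) *s curve_deriv p z - F (p z) = z ^ K *s \<gamma> z"
    using K by auto
  define \<Gamma> where "\<Gamma> = norm (\<gamma> 0) + 1"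
  have \<Gamma>0: "0 < \<Gamma>" by (simp add: \<Gamma>_def add_nonneg_pos)
  \<comment> \<open>Now \<open>\<Gamma>\<close> is half of M |c| K, and L M is at most the other
    half. Hence (L M + \<Gamma>) / (|c| K) \<le> M, so the Picard map preserves the bound M
    |z|^K.\<close>
  define M where "M = 2 * \<Gamma> / (cmod c * real K)"
  have M: "0 < M" using \<Gamma>0 cK by (simp add: M_def)
  obtain \<rho>1 where \<rho>1: "0 < \<rho>1" "\<rho>1 \<le> \<rho>0" "\<And>z. z \<in> ball 0 \<rho>1 \<Longrightarrow> norm (p z) < \<delta> / 2"
    using holomorphic_curve_shrink[OF p(1) \<rho>0 p(2), of "\<delta>/2"] \<delta>(1) by auto
  obtain \<rho>2 where \<rho>2: "0 < \<rho>2" "\<rho>2 \<le> \<rho>0" "\<And>z. z \<in> ball 0 \<rho>2 \<Longrightarrow> norm (\<gamma> z - \<gamma> 0) < 1"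
    using holomorphic_curve_shrink[OF holomorphic_curve_diff[OF \<gamma>(1) holomorphic_curve_const[of _ "\<gamma> 0"]] \<rho>0, of 1] by auto
  \<comment> \<open>In order: \<open>p\<close> stays below \<open>\<delta> / 2\<close>;
    \<open>\<gamma>\<close> stays below \<open>\<Gamma>\<close>; |z|^K is at most |z|; and
    corrections stay below \<open>\<delta> / 2\<close>.\<close>
  define \<rho> where "\<rho> = min (min \<rho>1 \<rho>2) (min 1 (\<delta> / (2 * M)))"
  have \<rho>: "0 < \<rho>" "\<rho> \<le> \<rho>0" "\<rho> \<le> 1" "\<rho> \<le> \<delta> / (2 * M)"
    using \<rho>1(1,2) \<rho>2(1,2) \<delta>(1) M by (auto simp: \<rho>_def)
  then have \<rho>M: "\<rho> * M \<le> \<delta> / 2" using M by (simp add: field_simps)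
  have p_small: "norm (p z) < \<delta> / 2" if "z \<in> ball 0 \<rho>" for z
    using that by (intro \<rho>1(3)) (auto simp: \<rho>_def)
  have \<gamma>_bound: "norm (\<gamma> z) \<le> \<Gamma>" if "z \<in> ball 0 \<rho>" for z
    using that \<rho>2(3)[of z] norm_triangle_sub[of "\<gamma> z" "\<gamma> 0"] by (auto simp: \<rho>_def \<Gamma>_def)
  note sub = subset_ball[OF \<rho>(2), of 0]
  have p': "holomorphic_curve (ball 0 \<rho>) p" and \<gamma>': "holomorphic_curve (ball 0 \<rho>) \<gamma>"
    using p(1) \<gamma>(1) holomorphic_curve_subset[OF _ sub] by auto
  have zK: "cmod z ^ K \<le> cmod z" "cmod z ^ K \<le> 1" if "z \<in> ball 0 \<rho>" for z
    using that \<rho>(3) K power_decreasing[of 1 K "cmod z"] by (auto simp: power_le_one)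

  define \<W> where "\<W> = {w :: complex \<Rightarrow> complex ^ 'n. holomorphic_curve (ball 0 \<rho>) w \<and> (\<forall>z\<in>ball 0 \<rho>. norm (w z) \<le> M * cmod z ^ K)}"
  \<comment> \<open>Substituting p + w into the equation leaves c z w' = G w.\<close>
  define G where "G = (\<lambda>w z. F (p z + w z) - F (p z) - z ^ K *s \<gamma> z)"
  have small: "norm (p z + w z) < \<delta>" if "z \<in> ball 0 \<rho>" "norm (w z) \<le> M * cmod z ^ K" for w z
  proof -
    have "M * cmod z ^ K \<le> M * cmod z" using zK(1)[OF that(1)] M by simp
    also have "\<dots> \<le> \<rho> * M" using that M by (simp add: mult.commute)
    finally show ?thesis using that(2) p_small[OF that(1)] \<rho>M norm_triangle_ineq[of "p z" "w z"] by linarith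
  qed
  have Glip: "norm (G w z - G w' z) \<le> L * norm (w z - w' z)"
    if "z \<in> ball 0 \<rho>" "norm (w z) \<le> M * cmod z ^ K" "norm (w' z) \<le> M * cmod z ^ K" for w w' z
    using lip[OF small[where w = w, OF that(1,2)] small[where w = w', OF that(1,3)]] by (simp add: G_def)
  have contract: "norm (W z - W' z) \<le> D / 2 * cmod z ^ K"
    if hyp: "holomorphic_curve (ball 0 \<rho>) W" "holomorphic_curve (ball 0 \<rho>) W'" "W 0 = W' 0" "0 \<le> D" "z \<in> ball 0 \<rho>"
      and bnd: "\<And>z. z \<in> ball 0 \<rho> \<Longrightarrow> norm ((c * z) *s curve_deriv W z - (c * z) *s curve_deriv W' z) \<le> L * D * cmod z ^ K"
    for W W' D z
  proof -
    have "norm (W z - W' z) \<le> L * D / (cmod c * real K) * cmod z ^ K"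
    proof (rule holomorphic_curve_norm_le_of_curve_deriv[OF holomorphic_curve_diff[OF hyp(1,2)] _ \<open>c \<noteq> 0\<close> _ _ hyp(5)])
      show "norm ((c * z) *s curve_deriv (\<lambda>z. W z - W' z) z) \<le> L * D * cmod z ^ K" if z: "z \<in> ball 0 \<rho>" for z
        using bnd[OF z] curve_deriv_diff[OF hyp(1,2) open_ball z] by (simp add: vector_ssub_ldistrib)
    qed (use K \<open>W 0 = W' 0\<close> in auto)
    also have "L * D / (cmod c * real K) \<le> D / 2"
      using mult_right_mono[OF K(2) \<open>0 \<le> D\<close>] cK by (simp add: field_simps)
    finally show ?thesis by (simp add: mult_right_mono)
  qed

  \<comment> \<open>\<open>G w\<close> vanishes at 0, so the equation for \<open>W\<close> can be
    integrated; the choice of \<open>M\<close> keeps \<open>W\<close> in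
    \<open>\<W>\<close>.\<close>
  have "\<exists>W\<in>\<W>. W 0 = 0 \<and> (\<forall>z\<in>ball 0 \<rho>. (c * z) *s curve_deriv W z = G w z)" if "w \<in> \<W>" for w
  proof -
    have w: "holomorphic_curve (ball 0 \<rho>) w" "\<And>z. z \<in> ball 0 \<rho> \<Longrightarrow> norm (w z) \<le> M * cmod z ^ K"
      using that by (auto simp: \<W>_def)
    have "w 0 = 0" using w(2)[of 0] \<rho>(1) K by (simp add: zero_power)
    have "(\<lambda>z. p z + w z) ` ball 0 \<rho> \<subseteq> ball 0 r" using small w(2) \<delta>(2) by fastforce
    moreover have "p ` ball 0 \<rho> \<subseteq> ball 0 r" using p(4) sub by blast
    ultimately have "holomorphic_curve (ball 0 \<rho>) (G w)" unfolding G_def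
      by (intro holomorphic_curve_diff holomorphic_curve_smult holomorphic_curve_compose[OF F(1)] holomorphic_curve_add p' \<gamma>' w open_ball holomorphic_intros)
    moreover have "G w 0 = 0" using K by (simp add: G_def \<open>w 0 = 0\<close>)
    ultimately obtain W where W: "holomorphic_curve (ball 0 \<rho>) W" "W 0 = 0"
      "\<And>z. z \<in> ball 0 \<rho> \<Longrightarrow> (c * z) *s curve_deriv W z = G w z"
      using holomorphic_curve_solve_curve_deriv \<open>c \<noteq> 0\<close> \<rho>(1) by blast
    have "norm (W z) \<le> M * cmod z ^ K" if z: "z \<in> ball 0 \<rho>" for z
    proof -
      have "norm (W z) \<le> (L * M + \<Gamma>) / (cmod c * real K) * cmod z ^ K"
      proof (rule holomorphic_curve_norm_le_of_curve_deriv[OF W(1,2) \<open>c \<noteq> 0\<close> _ _ z])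
        fix z :: complex assume z: "z \<in> ball 0 \<rho>"
        have "norm (F (p z + w z) - F (p z)) \<le> L * norm (w z)"
          using lip[OF small[where w = w, OF z w(2)[OF z]], of "p z"] p_small[OF z] \<delta>(1) by simp
        also have "\<dots> \<le> L * (M * cmod z ^ K)" using w(2)[OF z] L by simp
        finally have "norm (F (p z + w z) - F (p z)) \<le> L * M * cmod z ^ K" by simp
        moreover have "norm (z ^ K *s \<gamma> z) \<le> \<Gamma> * cmod z ^ K"
          using mult_left_mono[OF \<gamma>_bound[OF z], of "cmod z ^ K"]
          by (simp add: norm_vector_smult_complex norm_power mult.commute)
        ultimately show "norm ((c * z) *s curve_deriv W z) \<le> (L * M + \<Gamma>) * cmod z ^ K"
          unfolding W(3)[OF z] G_def
          using norm_triangle_ineq4[of "F (p z + w z) - F (p z)" "z ^ K *s \<gamma> z"]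
          by (simp add: distrib_right)
      qed (use K in auto)
      also have "(L * M + \<Gamma>) / (cmod c * real K) \<le> M"
      proof -
        have "M * (2 * L) \<le> M * (cmod c * real K)" using K(2) M by (intro mult_left_mono) auto
        moreover have "M * (cmod c * real K) = 2 * \<Gamma>"
          using \<open>c \<noteq> 0\<close> K(1) by (simp add: M_def)
        ultimately have "L * M + \<Gamma> \<le> M * (cmod c * real K)" by (simp add: mult.commute)
        then show ?thesis using cK by (simp add: pos_divide_le_eq)
      qed
      finally show ?thesis by (simp add: mult_right_mono)
    qed
    then show ?thesis using W by (intro bexI[of _ W]) (auto simp: \<W>_def)
  qed
  then obtain P where P: "\<And>w. w \<in> \<W> \<Longrightarrow> P w \<in> \<W> \<and> P w 0 = 0 \<and>
      (\<forall>z\<in>ball 0 \<rho>. (c * z) *s curve_deriv (P w) z = G w z)"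
    by metis

  define w where "w = (\<lambda>n. (P ^^ n) (\<lambda>_. 0))"
  have w_in: "w n \<in> \<W>" for n
    by (induction n) (use P M in \<open>auto simp: w_def \<W>_def holomorphic_curve_const\<close>)
  have w_Suc: "w (Suc n) 0 = 0" "\<And>z. z \<in> ball 0 \<rho> \<Longrightarrow> (c * z) *s curve_deriv (w (Suc n)) z = G (w n) z" for n
    using P[OF w_in[of n]] by (auto simp: w_def)
  have w_vhol: "holomorphic_curve (ball 0 \<rho>) (w n)" and w_bound: "\<And>z. z \<in> ball 0 \<rho> \<Longrightarrow> norm (w n z) \<le> M * cmod z ^ K" for n
    using w_in[of n] by (auto simp: \<W>_def)
  have step: "norm (w (Suc n) z - w n z) \<le> M * (1/2) ^ n * cmod z ^ K" if "z \<in> ball 0 \<rho>" for n z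
    \<comment> \<open>The point \<open>z\<close> is generalised because integration to
      \<open>z\<close> needs the previous bound at other points of the disc.\<close>
    using that
  proof (induction n arbitrary: z)
    case 0
    then show ?case using w_bound[of z 1] by (simp add: w_def)
  next
    case (Suc n)
    have "norm (w (Suc (Suc n)) z - w (Suc n) z) \<le> M * (1/2) ^ n / 2 * cmod z ^ K"
    proof (rule contract[OF w_vhol w_vhol _ _ Suc.prems])
      fix z :: complex assume z: "z \<in> ball 0 \<rho>"
      have "norm (G (w (Suc n)) z - G (w n) z) \<le> L * norm (w (Suc n) z - w n z)"
        by (rule Glip[where w = "w (Suc n)" and w' = "w n", OF z w_bound[OF z] w_bound[OF z]])
      also have "\<dots> \<le> L * (M * (1/2) ^ n * cmod z ^ K)"
        using Suc.IH[OF z] L by simp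
      finally show "norm ((c * z) *s curve_deriv (w (Suc (Suc n))) z - (c * z) *s curve_deriv (w (Suc n)) z)
          \<le> L * (M * (1/2) ^ n) * cmod z ^ K"
        unfolding w_Suc(2)[OF z] by (simp add: mult.assoc)
    qed (use w_Suc(1) M in auto)
    then show ?case by simp
  qed
  have "norm (w (Suc n) z - w n z) \<le> M * (1/2) ^ n" if "z \<in> ball 0 \<rho>" for n z
  proof -
    have "M * (1/2) ^ n * cmod z ^ K \<le> M * (1/2) ^ n * 1"
      using zK(2)[OF that] M by (intro mult_left_mono) auto
    with step[OF that, of n] show ?thesis by linarith
  qed
  then obtain l where ul: "uniform_limit (ball 0 \<rho>) w l sequentially"
    by (rule uniform_limit_of_geometric_steps)
  have l: "holomorphic_curve (ball 0 \<rho>) l" by (rule holomorphic_curve_uniform_limit(1)[OF w_vhol ul])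
  have lim_l: "(\<lambda>n. w n z) \<longlonglongrightarrow> l z" if "z \<in> ball 0 \<rho>" for z
    by (rule tendsto_uniform_limitI[OF ul that])
  have l_bound: "norm (l z) \<le> M * cmod z ^ K" if "z \<in> ball 0 \<rho>" for z
    by (rule Lim_bounded[OF tendsto_norm[OF lim_l[OF that]]]) (use w_bound[OF that] in auto)
  have l_eq: "(c * z) *s curve_deriv l z = G l z" if z: "z \<in> ball 0 \<rho>" for z
  proof (rule LIMSEQ_unique)
    have "(\<lambda>n. curve_deriv (w (Suc n)) z) \<longlonglongrightarrow> curve_deriv l z"
      using holomorphic_curve_uniform_limit(2)[OF w_vhol ul z] by (rule LIMSEQ_Suc)
    then have "(\<lambda>n. (c * z) *s curve_deriv (w (Suc n)) z) \<longlonglongrightarrow> (c * z) *s curve_deriv l z"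
      by (intro vec_tendstoI) (auto intro!: tendsto_intros)
    then show "(\<lambda>n. G (w n) z) \<longlonglongrightarrow> (c * z) *s curve_deriv l z" by (simp add: w_Suc(2)[OF z])
    show "(\<lambda>n. G (w n) z) \<longlonglongrightarrow> G l z"
    proof (rule Lim_null_comparison[THEN LIM_zero_cancel])
      show "\<forall>\<^sub>F n in sequentially. norm (G (w n) z - G l z) \<le> L * norm (w n z - l z)"
        using Glip[where w = "w _" and w' = l, OF z w_bound[OF z] l_bound[OF z]] by simp
      show "(\<lambda>n. L * norm (w n z - l z)) \<longlonglongrightarrow> 0"
        using lim_l[OF z] by (intro tendsto_mult_right_zero tendsto_norm_zero LIM_zero)
    qed
  qed
  \<comment> \<open>Because K \<ge> 2, the correction is O(z^2) and does not change the tangent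
    vector \<open>v\<close> of \<open>p\<close>.\<close>
  have vdl: "curve_deriv l 0 = 0"
  proof -
    have "((\<lambda>z. inverse (z ^ 1) *s l z) \<longlongrightarrow> 0) (at 0)"
    proof (rule Lim_null_comparison)
      have "norm (inverse (z ^ 1) *s l z) \<le> M * cmod z" if "z \<noteq> 0" "z \<in> ball 0 \<rho>" for z
      proof -
        have "cmod z ^ K \<le> cmod z ^ 2"
          using that \<rho>(3) K by (intro power_decreasing) auto
        then have "norm (l z) \<le> M * (cmod z * cmod z)"
          using l_bound[OF that(2)] M by (simp add: power2_eq_square) (meson less_imp_le mult_left_mono order_trans)
        then show ?thesis using that(1)
          by (simp add: norm_vector_smult_complex norm_divide field_simps)
      qed
      then show "\<forall>\<^sub>F z in at 0. norm (inverse (z ^ 1) *s l z) \<le> M * cmod z"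
        using \<rho>(1) unfolding eventually_at by (intro exI[of _ \<rho>]) auto
      show "((\<lambda>z. M * cmod z) \<longlongrightarrow> 0) (at (0::complex))"
        by (intro tendsto_mult_right_zero tendsto_norm_zero tendsto_ident_at)
    qed
    from holomorphic_curve_factor_power[OF l \<rho>(1) this] obtain g where
      g: "holomorphic_curve (ball 0 \<rho>) g" "\<And>z. z \<in> ball 0 \<rho> \<Longrightarrow> l z = z ^ 2 *s g z"
      by (auto simp: numeral_2_eq_2)
    have "((\<lambda>z. l z $ i) has_field_derivative 0) (at 0)" for i
    proof (rule has_field_derivative_transform_within_open[OF _ open_ball[of 0 \<rho>]])
      show "((\<lambda>z. z ^ 2 * g z $ i) has_field_derivative 0) (at 0)"
        using \<rho>(1) by (auto intro!: derivative_eq_intros holomorphic_curve_has_field_derivative[OF g(1)])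
    qed (use \<rho>(1) g(2) in auto)
    then show ?thesis by (intro curve_derivI) simp
  qed

  show thesis
  proof (rule that[of \<rho> "\<lambda>z. p z + l z"])
    show "holomorphic_curve (ball 0 \<rho>) (\<lambda>z. p z + l z)" by (intro holomorphic_curve_add p' l)
    show "p 0 + l 0 = 0" using l_bound[of 0] \<rho>(1) K p(2) by (simp add: zero_power)
    show "curve_deriv (\<lambda>z. p z + l z) 0 = v"
      using curve_deriv_add[OF p' l open_ball] \<rho>(1) by (simp add: vdl p(3))
    show "(\<lambda>z. p z + l z) ` ball 0 \<rho> \<subseteq> ball 0 r" using small l_bound \<delta>(2) by fastforce
    show "(c * z) *s curve_deriv (\<lambda>z. p z + l z) z = F (p z + l z)" if z: "z \<in> ball 0 \<rho>" for z
    proof -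
      have "(c * z) *s curve_deriv (\<lambda>z. p z + l z) z = (c * z) *s curve_deriv p z + G l z"
        using curve_deriv_add[OF p' l open_ball z] l_eq[OF z] by (simp add: vector_add_ldistrib)
      also have "(c * z) *s curve_deriv p z = F (p z) + z ^ K *s \<gamma> z"
        using \<gamma>(2)[of z] z \<rho>(2) by (simp add: diff_eq_eq add.commute)
      finally show ?thesis by (simp add: G_def)
    qed
  qed (rule \<rho>(1))
qed

section \<open>Graphs of holomorphic curves\<close>

text \<open>One form covers both the equations of a graph and the components of the shears that
  flatten it, by varying the coefficient \<open>a\<close>.\<close>

lemma holomorphic_fun_component_plus:
  fixes S :: "(complex ^ 'n::finite) set"
  assumes g: "g holomorphic_on \<Omega>" "open \<Omega>" and S: "\<And>x. x \<in> S \<Longrightarrow> x $ k \<in> \<Omega>"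
  shows "holomorphic_fun S (\<lambda>x. x $ i + a * g (x $ k))"
  unfolding holomorphic_fun_def
proof
  fix x assume x: "x \<in> S"
  have nth: "((\<lambda>x. x $ j) has_derivative (\<lambda>v. v $ j)) (at x within S)" for j
    by (rule bounded_linear_imp_has_derivative[OF bounded_linear_vec_nth])
  have "(g has_derivative (\<lambda>c. c * deriv g (x $ k))) (at (x $ k))"
    using holomorphic_derivI[OF g S[OF x], of UNIV] by (simp add: has_field_derivative_iff_left)
  from has_derivative_compose[OF nth this]
  have "((\<lambda>x. x $ i + a * g (x $ k)) has_derivative (\<lambda>v. v $ i + a * (v $ k * deriv g (x $ k))))
      (at x within S)"
    by (intro has_derivative_add nth has_derivative_mult_right)
  then show "\<exists>D. ((\<lambda>x. x $ i + a * g (x $ k)) has_derivative D) (at x within S) \<and>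
      (\<forall>c v. D (c *s v) = c * D v)"
    by (intro exI conjI) (auto simp: algebra_simps)
qed

lemma regular_pointE:
  fixes A :: "(complex ^ 'n::finite) set"
  assumes "regular_point A d p"
  obtains V W \<phi> \<psi> and I :: "'n set" where "p \<in> A" "open V" "p \<in> V" "open W" "homeomorphism V W \<phi> \<psi>"
    "holomorphic_map V \<phi>" "holomorphic_map W \<psi>" "card I = d"
    "\<phi> ` (A \<inter> V) = {w \<in> W. \<forall>i. i \<notin> I \<longrightarrow> w $ i = 0}"
  using assms unfolding regular_point_def by (elim conjE exE) (rule that; assumption)

context
  fixes \<Omega> :: "complex set" and H :: "complex \<Rightarrow> complex ^ 'n::finite" and k :: 'n
  assumes H: "holomorphic_curve \<Omega> H" and \<Omega>: "open \<Omega>" and Hk: "\<And>\<zeta>. \<zeta> \<in> \<Omega> \<Longrightarrow> H \<zeta> $ k = \<zeta>"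
begin

lemma mem_graph_iff: "x \<in> H ` \<Omega> \<longleftrightarrow> x $ k \<in> \<Omega> \<and> x = H (x $ k)"
  using Hk by auto

lemma open_graph_domain: "open {x :: complex ^ 'n. x $ k \<in> \<Omega>}"
  using open_vimage_vec_nth[OF \<Omega>] by (simp add: vimage_def)

text \<open>The equations x_i = H_i(x_k), one for each coordinate, define the graph globally, so the
  same neighbourhood serves every point.\<close>

lemma analytic_subset_graph:
  assumes B: "open B" "H ` \<Omega> \<subseteq> B"
  shows "analytic_subset {x \<in> B. x $ k \<in> \<Omega>} (H ` \<Omega>)"
  unfolding analytic_subset_def
proof (intro conjI ballI)
  let ?U = "{x \<in> B. x $ k \<in> \<Omega>}"
  show "H ` \<Omega> \<subseteq> ?U" using B(2) Hk by auto
  fix p assume p: "p \<in> ?U"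
  define fs where "fs = range (\<lambda>i x. x $ i + (- 1) * H (x $ k) $ i)"
  show "\<exists>V fs. open V \<and> p \<in> V \<and> V \<subseteq> ?U \<and> finite fs \<and> (\<forall>f\<in>fs. holomorphic_fun V f) \<and>
      H ` \<Omega> \<inter> V = {x \<in> V. \<forall>f\<in>fs. f x = 0}"
  proof (intro exI conjI)
    show "open ?U" using B(1) open_graph_domain by (simp add: Collect_conj_eq open_Int)
    show "finite fs" by (simp add: fs_def)
    show "\<forall>f\<in>fs. holomorphic_fun ?U f"
    proof
      fix f assume "f \<in> fs"
      then obtain i where f: "f = (\<lambda>x. x $ i + (- 1) * H (x $ k) $ i)" by (auto simp: fs_def)
      have "(\<lambda>\<zeta>. H \<zeta> $ i) holomorphic_on \<Omega>" using H by (simp add: holomorphic_curve_def)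
      from holomorphic_fun_component_plus[OF this \<Omega>, of ?U] show "holomorphic_fun ?U f"
        unfolding f by blast
    qed
    show "H ` \<Omega> \<inter> ?U = {x \<in> ?U. \<forall>f\<in>fs. f x = 0}"
      using mem_graph_iff by (auto simp: fs_def vec_eq_iff Hk)
  qed (use p in auto)
qed

text \<open>The shear subtracting H(x_k) in all coordinates except \<open>k\<close> flattens the
  graph onto the \<open>k\<close>-axis. As it leaves x_k fixed, adding H(x_k) back inverts
  it.\<close>

lemma regular_point_graph:
  assumes p: "p \<in> H ` \<Omega>"
  shows "regular_point (H ` \<Omega>) 1 p"
proof -
  define V where "V = {x :: complex ^ 'n. x $ k \<in> \<Omega>}"
  define \<phi> where "\<phi> = (\<lambda>x. \<chi> i. x $ i + (if i = k then 0 else - 1) * H (x $ k) $ i)"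
  define \<psi> where "\<psi> = (\<lambda>x. \<chi> i. x $ i + (if i = k then 0 else 1) * H (x $ k) $ i)"
  have V: "open V" unfolding V_def by (rule open_graph_domain)
  have hol: "holomorphic_map V (\<lambda>x. \<chi> i. x $ i + a i * H (x $ k) $ i)" for a
    using H \<Omega> unfolding holomorphic_map_def vec_lambda_beta holomorphic_curve_def
    by (auto simp: V_def intro!: holomorphic_fun_component_plus)
  have hol\<phi>: "holomorphic_map V \<phi>" unfolding \<phi>_def by (rule hol)
  have hol\<psi>: "holomorphic_map V \<psi>" unfolding \<psi>_def by (rule hol)
  have nth_k: "\<phi> x $ k = x $ k" "\<psi> x $ k = x $ k" for x
    by (simp_all add: \<phi>_def \<psi>_def)
  have inv: "\<psi> (\<phi> x) = x" "\<phi> (\<psi> x) = x" for x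
    using nth_k[of x] by (auto simp: \<phi>_def \<psi>_def vec_eq_iff)
  have homeo: "homeomorphism V V \<phi> \<psi>"
  proof (rule homeomorphismI)
    show "continuous_on V \<phi>" "continuous_on V \<psi>"
      using holomorphic_map_continuous_on[OF _ V] hol\<phi> hol\<psi> by auto
  qed (auto simp: V_def nth_k inv)
  have *: "\<phi> x \<in> {w \<in> V. \<forall>i. i \<notin> {k} \<longrightarrow> w $ i = 0} \<longleftrightarrow> x \<in> H ` \<Omega>" for x
  proof (cases "x $ k \<in> \<Omega>")
    case True
    have "\<phi> x $ i = x $ i - H (x $ k) $ i" if "i \<noteq> k" for i
      using that by (simp add: \<phi>_def)
    then have "(\<forall>i. i \<notin> {k} \<longrightarrow> \<phi> x $ i = 0) \<longleftrightarrow> x = H (x $ k)"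
      using Hk[OF True] unfolding vec_eq_iff by (metis eq_iff_diff_eq_0 singletonD singletonI)
    then show ?thesis using True unfolding mem_graph_iff by (simp add: V_def nth_k)
  qed (simp add: mem_graph_iff V_def nth_k)
  have "\<phi> ` (H ` \<Omega> \<inter> V) = {w \<in> V. \<forall>i. i \<notin> {k} \<longrightarrow> w $ i = 0}"
  proof (intro equalityI subsetI)
    fix w assume "w \<in> \<phi> ` (H ` \<Omega> \<inter> V)"
    then show "w \<in> {w \<in> V. \<forall>i. i \<notin> {k} \<longrightarrow> w $ i = 0}" using * by blast
  next
    fix w assume w: "w \<in> {w \<in> V. \<forall>i. i \<notin> {k} \<longrightarrow> w $ i = 0}"
    then have "\<psi> w \<in> H ` \<Omega>" using *[of "\<psi> w"] by (simp only: inv)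
    moreover have "\<psi> w \<in> V" using w by (auto simp: V_def nth_k)
    ultimately show "w \<in> \<phi> ` (H ` \<Omega> \<inter> V)" using inv(2)[of w] by (metis IntI imageI)
  qed
  moreover have "p \<in> V" using p mem_graph_iff by (auto simp: V_def)
  ultimately show ?thesis
    unfolding regular_point_def using p V homeo hol\<phi> hol\<psi>
    by (intro conjI exI[of _ V] exI[of _ \<phi>] exI[of _ \<psi>] exI[of _ "{k}"]) auto
qed

text \<open>Two free coordinates of a chart would give a continuous injection of an open subset of
  \<open>\<complex>\<^sup>2\<close> into \<open>\<complex>\<close>.\<close>

lemma regular_point_graph_le:
  assumes "regular_point (H ` \<Omega>) d p"
  shows "d \<le> 1"
proof (rule ccontr)
  assume d: "\<not> d \<le> 1"
  obtain V W \<phi> \<psi> and I :: "'n set" where p: "p \<in> H ` \<Omega>" "open V" "p \<in> V" and W: "open W"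
    and homeo: "homeomorphism V W \<phi> \<psi>" and "holomorphic_map V \<phi>" "holomorphic_map W \<psi>"
    and I: "card I = d" and img: "\<phi> ` (H ` \<Omega> \<inter> V) = {w \<in> W. \<forall>i. i \<notin> I \<longrightarrow> w $ i = 0}"
    by (rule regular_pointE[OF assms])
  have "\<exists>i\<in>I. \<exists>j\<in>I. i \<noteq> j"
    using d I card_le_Suc0_iff_eq[of I] by auto
  then obtain i j where ij: "i \<in> I" "j \<in> I" "i \<noteq> j" by blast
  \<comment> \<open>An affine copy of a complex plane through \<open>\<phi> p\<close>; its part in
    \<open>W\<close> lies in the flattened graph. Pulled back to the graph, its points are
    determined by coordinate \<open>k\<close>.\<close>
  define w where "w = (\<lambda>q::complex \<times> complex. \<phi> p + fst q *s axis i 1 + snd q *s axis j 1)"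
  define S where "S = w -` W"
  have cont_w: "continuous_on UNIV w" unfolding w_def
    by (intro continuous_intros bounded_linear.continuous_on[OF bounded_linear_smult_left])
  have "open S" unfolding S_def using open_vimage[OF W cont_w] .
  have \<phi>p: "\<phi> p \<in> {w \<in> W. \<forall>i. i \<notin> I \<longrightarrow> w $ i = 0}" using p img by blast
  have "0 \<in> S" using \<phi>p by (simp add: S_def w_def)
  have \<psi>w: "\<psi> (w q) \<in> H ` \<Omega>" if "q \<in> S" for q
  proof -
    have "w q \<in> {w \<in> W. \<forall>i. i \<notin> I \<longrightarrow> w $ i = 0}"
      using that \<phi>p ij by (auto simp: S_def w_def axis_def)
    then obtain x where "x \<in> H ` \<Omega>" "x \<in> V" "w q = \<phi> x" unfolding img[symmetric] by blast
    then show ?thesis using homeomorphism_apply1[OF homeo] by simp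
  qed
  have "continuous_on S (\<lambda>q. \<psi> (w q) $ k)"
  proof (rule continuous_on_component, rule continuous_on_compose2[OF homeomorphism_cont2[OF homeo]])
    show "continuous_on S w" using cont_w continuous_on_subset by blast
  qed (auto simp: S_def)
  moreover have "inj_on (\<lambda>q. \<psi> (w q) $ k) S"
  proof (rule inj_onI)
    fix q q' assume q: "q \<in> S" "q' \<in> S" "\<psi> (w q) $ k = \<psi> (w q') $ k"
    then have "\<psi> (w q) = \<psi> (w q')" using \<psi>w mem_graph_iff by metis
    then have "w q = w q'"
      using q homeomorphism_apply2[OF homeo] unfolding S_def by (metis vimageE)
    then have "w q $ i = w q' $ i" "w q $ j = w q' $ j" by simp_all
    then show "q = q'" using ij(3) by (auto simp: w_def axis_def prod_eq_iff)
  qed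
  \<comment> \<open>The dimensions are real: 4 on the left, 2 on the right.\<close>
  ultimately have "DIM(complex \<times> complex) \<le> DIM(complex)"
    using \<open>open S\<close> \<open>0 \<in> S\<close> by (intro invariance_of_dimension) auto
  then show False by simp
qed

lemma pure_dimensional_graph: "pure_dimensional (H ` \<Omega>) 1"
  unfolding pure_dimensional_def dim_at_def
proof
  fix p assume p: "p \<in> H ` \<Omega>"
  let ?D = "{d. \<forall>N. open N \<and> p \<in> N \<longrightarrow> (\<exists>z\<in>N. regular_point (H ` \<Omega>) d z)}"
  have "?D \<subseteq> {..1}"
    using regular_point_graph_le by auto
  moreover have "1 \<in> ?D" using regular_point_graph[OF p] by blast
  ultimately show "Max ?D = 1"
    by (intro Max_eqI) (auto intro: finite_subset)
qed

end

text \<open>In the parameter z the flow is the rotation by \<omega> t, so the orbits are the images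
  of circles about 0. Injectivity of \<open>h\<close> transfers the least period of the rotation to
  them.\<close>

lemma isoperiodic_disc:
  fixes F :: "complex ^ 'n::finite \<Rightarrow> complex ^ 'n" and \<omega> :: real
  assumes h: "holomorphic_curve (ball 0 \<rho>) h" "h 0 = 0" "h ` ball 0 \<rho> \<subseteq> D" "inj_on h (ball 0 \<rho>)" and "0 < \<rho>"
    and eq: "\<And>z. z \<in> ball 0 \<rho> \<Longrightarrow> (of_real \<omega> * \<i> * z) *s curve_deriv h z = F (h z)" and "\<omega> \<noteq> 0"
  shows "consists_of_zero_and_isoperiodic_orbits F D (h ` ball 0 \<rho>)"
proof -
  define x where "x = (\<lambda>a t. h (a * exp (\<i> * of_real (\<omega> * t))))"
  define T where "T = 2 * pi / \<bar>\<omega>\<bar>"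
  have T: "0 < T" using \<open>\<omega> \<noteq> 0\<close> by (simp add: T_def)
  have norm_exp: "cmod (a * exp (\<i> * of_real (\<omega> * t))) = cmod a" for a t
    by (simp add: norm_mult)
  have orbit: "periodic_orbit F D T (range (x a))" if a: "a \<in> ball 0 \<rho>" "a \<noteq> 0" for a
  proof -
    have z: "a * exp (\<i> * of_real (\<omega> * t)) \<in> ball 0 \<rho>" for t
      using a(1) norm_exp[of a t] by simp
    have sol: "solution_on_line F D (x a)"
      unfolding solution_on_line_def
    proof (intro allI conjI)
      fix t
      show "x a t \<in> D" using h(3) z[of t] unfolding x_def by blast
      let ?z = "a * exp (\<i> * of_real (\<omega> * t))"
      have "((\<lambda>t. a * exp (\<i> * of_real (\<omega> * t))) has_vector_derivative of_real \<omega> * \<i> * ?z) (at t)"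
      proof -
        have "((\<lambda>s. a * exp (\<i> * (of_real \<omega> * s))) has_field_derivative of_real \<omega> * \<i> * ?z) (at (of_real t))"
          by (auto intro!: derivative_eq_intros)
        from has_vector_derivative_real_field[OF this] show ?thesis by simp
      qed
      then have "((\<lambda>t. a * exp (\<i> * of_real (\<omega> * t))) has_derivative
          (\<lambda>s. s *\<^sub>R (of_real \<omega> * \<i> * ?z))) (at t)"
        unfolding has_vector_derivative_def .
      from has_derivative_compose[OF this holomorphic_curve_has_derivative[OF h(1) open_ball z]]
      have "(x a has_derivative (\<lambda>s. s *\<^sub>R ((of_real \<omega> * \<i> * ?z) *s curve_deriv h ?z))) (at t)"
        unfolding x_def by (simp add: scaleR_eq_smult_complex scaleR_conv_of_real vector_smult_assoc)
      then show "(x a has_vector_derivative F (x a t)) (at t)"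
        unfolding has_vector_derivative_def eq[OF z] by (simp add: x_def)
    qed
    \<comment> \<open>Whether \<open>s\<close> is a period depends only on exp(\<i> \<omega> s) = 1,
      for every \<open>t\<close> and every circle.\<close>
    have shift: "x a (t + s) = x a t \<longleftrightarrow> (\<exists>n::int. \<omega> * s = 2 * pi * n)" for t s
    proof -
      have "x a (t + s) = x a t \<longleftrightarrow>
          a * exp (\<i> * of_real (\<omega> * (t + s))) = a * exp (\<i> * of_real (\<omega> * t))"
        unfolding x_def using inj_on_eq_iff[OF h(4) z z] .
      also have "exp (\<i> * of_real (\<omega> * (t + s))) = exp (\<i> * of_real (\<omega> * t)) * exp (\<i> * of_real (\<omega> * s))"
        by (simp add: exp_add[symmetric] algebra_simps)
      also have "a * (exp (\<i> * of_real (\<omega> * t)) * exp (\<i> * of_real (\<omega> * s))) = a * exp (\<i> * of_real (\<omega> * t))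
          \<longleftrightarrow> exp (\<i> * of_real (\<omega> * s)) = 1"
        using a(2) by simp
      also have "\<dots> \<longleftrightarrow> (\<exists>n::int. \<omega> * s = 2 * pi * n)"
        unfolding exp_eq_1 by (auto simp: mult_ac)
      finally show ?thesis .
    qed
    have per: "least_period (x a) T"
      unfolding least_period_def shift
    proof (intro conjI allI impI notI)
      have "\<omega> * T = 2 * pi * of_int (if 0 < \<omega> then 1 else - 1)"
        using \<open>\<omega> \<noteq> 0\<close> by (auto simp: T_def)
      then show "\<exists>n::int. \<omega> * T = 2 * pi * n" by blast
    next
      fix s :: real assume s: "0 < s \<and> s < T" "\<forall>t::real. \<exists>n::int. \<omega> * s = 2 * pi * n"
      then obtain n :: int where n: "\<omega> * s = 2 * pi * n" by blast
      have "\<bar>\<omega>\<bar> * s < 2 * pi" using s(1) \<open>\<omega> \<noteq> 0\<close> by (simp add: T_def field_simps)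
      moreover have "\<bar>\<omega>\<bar> * s = 2 * pi * \<bar>of_int n\<bar>" using arg_cong[OF n, of abs] s(1) by (simp add: abs_mult)
      ultimately have "\<bar>of_int n :: real\<bar> < 1" by simp
      then have "n = 0" by linarith
      then show False using n s(1) \<open>\<omega> \<noteq> 0\<close> by simp
    qed (use T in auto)
    moreover have "\<not> x a constant_on UNIV"
    proof
      assume "x a constant_on UNIV"
      then have "\<forall>t. x a (t + T / 2) = x a t" unfolding constant_on_def by auto
      moreover have "0 < T / 2" "T / 2 < T" using T by auto
      ultimately show False using per unfolding least_period_def by blast
    qed
    ultimately show ?thesis unfolding periodic_orbit_def using sol by blast
  qed
  have "h ` ball 0 \<rho> - {0} = h ` (ball 0 \<rho> - {0})"
    using h(2) inj_on_eq_iff[OF h(4), of _ 0] \<open>0 < \<rho>\<close> by auto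
  also have "\<dots> = \<Union> ((\<lambda>a. range (x a)) ` (ball 0 \<rho> - {0}))"
  proof (intro equalityI subsetI)
    fix y assume "y \<in> h ` (ball 0 \<rho> - {0})"
    then obtain a where "a \<in> ball 0 \<rho> - {0}" "y = h a" by blast
    moreover from this have "y \<in> range (x a)" by (auto simp: x_def intro: range_eqI[of _ _ 0])
    ultimately show "y \<in> \<Union> ((\<lambda>a. range (x a)) ` (ball 0 \<rho> - {0}))" by blast
  next
    fix y assume "y \<in> \<Union> ((\<lambda>a. range (x a)) ` (ball 0 \<rho> - {0}))"
    then obtain a where a: "a \<in> ball 0 \<rho> - {0}" "y \<in> range (x a)" by blast
    then obtain t where "y = x a t" by blast
    with a(1) show "y \<in> h ` (ball 0 \<rho> - {0})"
      unfolding x_def using norm_exp[of a t]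
      by (intro image_eqI[of _ h "a * exp (\<i> * of_real (\<omega> * t))"]) auto
  qed
  finally show ?thesis
    unfolding consists_of_zero_and_isoperiodic_orbits_def
    using orbit h(2) \<open>0 < \<rho>\<close>
    by (intro conjI exI[of _ T] exI[of _ "(\<lambda>a. range (x a)) ` (ball 0 \<rho> - {0})"])
      (auto intro!: image_eqI[of _ h 0])
qed

section \<open>From an imaginary eigenvalue to an isoperiodic variety\<close>

lemma matrix_eigenvalue_norm_le:
  fixes A :: "complex ^ 'n::finite ^ 'n"
  assumes "matrix_eigenvalue A \<mu>"
  shows "cmod \<mu> \<le> onorm ((*v) A)"
proof -
  obtain v where "v \<noteq> 0" "A *v v = \<mu> *s v" using assms by (auto simp: matrix_eigenvalue_def)
  then show ?thesis using norm_matrix_vector_mult_le[of A v] by (simp add: norm_vector_smult_complex)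
qed

text \<open>Eigenvalues are bounded by the operator norm, so only finitely many positive multiples
  of \<omega> \<i> are eigenvalues. The largest of these has no eigenvalue among its own multiples
  by k \<ge> 2.\<close>

lemma nonresonant_multiple:
  fixes A :: "complex ^ 'n::finite ^ 'n" and \<omega> :: real
  assumes "matrix_eigenvalue A (of_real \<omega> * \<i>)" "\<omega> \<noteq> 0"
  obtains \<omega>' :: real where "\<omega>' \<noteq> 0" "matrix_eigenvalue A (of_real \<omega>' * \<i>)"
    "\<And>k::nat. 2 \<le> k \<Longrightarrow> \<not> matrix_eigenvalue A (of_nat k * (of_real \<omega>' * \<i>))"
proof -
  define S where "S = {m::nat. 1 \<le> m \<and> matrix_eigenvalue A (of_nat m * (of_real \<omega> * \<i>))}"
  have "S \<subseteq> {..nat \<lceil>onorm ((*v) A) / \<bar>\<omega>\<bar>\<rceil>}"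
  proof
    fix m assume "m \<in> S"
    then have "real m * \<bar>\<omega>\<bar> \<le> onorm ((*v) A)"
      using matrix_eigenvalue_norm_le by (fastforce simp: S_def norm_mult)
    then have "real m \<le> onorm ((*v) A) / \<bar>\<omega>\<bar>" using \<open>\<omega> \<noteq> 0\<close> by (simp add: field_simps)
    then show "m \<in> {..nat \<lceil>onorm ((*v) A) / \<bar>\<omega>\<bar>\<rceil>}" by simp linarith
  qed
  then have fin: "finite S" by (rule finite_subset) simp
  have "1 \<in> S" using assms(1) by (simp add: S_def)
  define M where "M = Max S"
  have M: "M \<in> S" unfolding M_def using fin \<open>1 \<in> S\<close> by (intro Max_in) auto
  show thesis
  proof (rule that[of "real M * \<omega>"])
    show "real M * \<omega> \<noteq> 0" "matrix_eigenvalue A (of_real (real M * \<omega>) * \<i>)"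
      using M assms(2) by (auto simp: S_def mult.assoc)
    fix k :: nat assume k: "2 \<le> k"
    show "\<not> matrix_eigenvalue A (of_nat k * (of_real (real M * \<omega>) * \<i>))"
    proof
      assume "matrix_eigenvalue A (of_nat k * (of_real (real M * \<omega>) * \<i>))"
      then have "k * M \<in> S" using M k by (simp add: S_def mult.assoc)
      then have "k * M \<le> M" unfolding M_def by (rule Max_ge[OF fin])
      then show False using k M by (simp add: S_def)
    qed
  qed
qed

text \<open>The invariant disc has tangent \<open>v\<close> at 0. A coordinate in which
  \<open>v\<close> is nonzero is a local parameter on the disc, so the image of a smaller disc is a
  graph over that coordinate.\<close>

lemma isoperiodic_variety_of_imaginary_eigenvalue:
  fixes F :: "complex ^ 'n::finite \<Rightarrow> complex ^ 'n" and r :: real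
  assumes F: "holomorphic_map (ball 0 r) F" "0 < r" "F 0 = 0"
    and "\<omega> \<noteq> 0" "matrix_eigenvalue (jacobian F (at 0)) (complex_of_real \<omega> * \<i>)"
  shows "\<exists>U A. open U \<and> 0 \<in> U \<and> U \<subseteq> ball 0 r \<and> analytic_subset U A \<and>
    pure_dimensional A 1 \<and> consists_of_zero_and_isoperiodic_orbits F (ball 0 r) A"
proof -
  obtain \<omega>' :: real where \<omega>': "\<omega>' \<noteq> 0" "matrix_eigenvalue (jacobian F (at 0)) (of_real \<omega>' * \<i>)"
    and nonres: "\<And>k::nat. 2 \<le> k \<Longrightarrow> \<not> matrix_eigenvalue (jacobian F (at 0)) (of_nat k * (of_real \<omega>' * \<i>))"
    using nonresonant_multiple assms(4,5) by blast
  obtain v where v: "v \<noteq> 0" "jacobian F (at 0) *v v = (of_real \<omega>' * \<i>) *s v"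
    using \<omega>'(2) by (auto simp: matrix_eigenvalue_def)
  have "\<forall>k::nat. 2 \<le> k \<longrightarrow> (\<forall>x. jacobian F (at 0) *v x = (of_nat k * (of_real \<omega>' * \<i>)) *s x \<longrightarrow> x = 0)"
    using nonres unfolding matrix_eigenvalue_def by blast
  from invariant_disc[OF F v(2) _ this] obtain \<rho> h where \<rho>: "0 < \<rho>" and h: "holomorphic_curve (ball 0 \<rho>) h" "h 0 = 0" "curve_deriv h 0 = v"
    "h ` ball 0 \<rho> \<subseteq> ball 0 r"
    and heq: "\<And>z. z \<in> ball 0 \<rho> \<Longrightarrow> (of_real \<omega>' * \<i> * z) *s curve_deriv h z = F (h z)"
    using \<omega>'(1) by auto
  obtain k where k: "v $ k \<noteq> 0" using v(1) by (auto simp: vec_eq_iff)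
  define hk where "hk = (\<lambda>z. h z $ k)"
  have hk: "hk holomorphic_on ball 0 \<rho>" using h(1) by (simp add: holomorphic_curve_def hk_def)
  have dnz: "deriv hk 0 \<noteq> 0" using h(3) k by (simp add: hk_def curve_deriv_def vec_eq_iff)
  have zero_in: "(0::complex) \<in> ball 0 \<rho>" using \<rho> by simp
  obtain s where s: "0 < s" "ball 0 s \<subseteq> (ball 0 \<rho> :: complex set)" "inj_on hk (ball 0 s)"
    by (rule has_complex_derivative_locally_injective[OF hk zero_in open_ball dnz])
  have hk_s: "hk holomorphic_on ball 0 s" using hk s(2) by (rule holomorphic_on_subset)
  obtain g where g: "g holomorphic_on hk ` ball 0 s" "\<And>z. z \<in> ball 0 s \<Longrightarrow> g (hk z) = z"
    using holomorphic_has_inverse[OF hk_s open_ball s(3)] by metis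
  define \<Omega> where "\<Omega> = hk ` ball 0 s"
  \<comment> \<open>Reparametrising by the inverse of \<open>hk\<close> makes the
    \<open>k\<close>-th coordinate the parameter itself.\<close>
  define H where "H = (\<lambda>\<zeta>. h (g \<zeta>))"
  have \<Omega>: "open \<Omega>" unfolding \<Omega>_def by (rule open_mapping_thm3[OF hk_s open_ball s(3)])
  have H: "holomorphic_curve \<Omega> H" unfolding holomorphic_curve_def H_def
  proof
    fix i
    have "(\<lambda>z. h z $ i) holomorphic_on ball 0 s"
      using h(1) s(2) by (auto simp: holomorphic_curve_def intro: holomorphic_on_subset)
    moreover have "g ` \<Omega> \<subseteq> ball 0 s" using g(2) unfolding \<Omega>_def by auto
    ultimately show "(\<lambda>\<zeta>. h (g \<zeta>) $ i) holomorphic_on \<Omega>"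
      using holomorphic_on_compose_gen[of g \<Omega> "\<lambda>z. h z $ i" "ball 0 s"] g(1)
      unfolding \<Omega>_def[symmetric] o_def by blast
  qed
  have Hk: "H \<zeta> $ k = \<zeta>" if "\<zeta> \<in> \<Omega>" for \<zeta>
    using that g(2) by (auto simp: \<Omega>_def H_def hk_def)
  have HA: "H ` \<Omega> = h ` ball 0 s"
    unfolding H_def \<Omega>_def using g(2) by (force simp: image_iff)
  have sub: "h ` ball 0 s \<subseteq> ball 0 r" using h(4) s(2) by blast
  have inj: "inj_on h (ball 0 s)"
    using s(3) unfolding hk_def inj_on_def by auto
  have "consists_of_zero_and_isoperiodic_orbits F (ball 0 r) (H ` \<Omega>)"
    unfolding HA using holomorphic_curve_subset[OF h(1) s(2)] h(2) sub inj s(1,2) heq \<omega>'(1)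
    by (intro isoperiodic_disc[where \<omega> = \<omega>']) auto
  moreover have "pure_dimensional (H ` \<Omega>) 1" by (rule pure_dimensional_graph[OF H \<Omega> Hk])
  moreover have "analytic_subset {x \<in> ball 0 r. x $ k \<in> \<Omega>} (H ` \<Omega>)"
    using sub HA by (intro analytic_subset_graph[OF H \<Omega> Hk]) auto
  moreover have "open {x \<in> ball 0 r. x $ k \<in> \<Omega>}"
    using open_Int[OF open_ball[of 0 r] open_graph_domain[OF H \<Omega> Hk]]
    by (simp only: Int_def mem_Collect_eq)
  moreover have "0 \<in> {x \<in> ball 0 r. x $ k \<in> \<Omega>}"
  proof -
    have "hk 0 \<in> \<Omega>" unfolding \<Omega>_def by (rule imageI) (simp add: s(1))
    then show ?thesis using F(2) h(2) by (simp add: hk_def)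
  qed
  ultimately show ?thesis
    by (intro exI[of _ "{x \<in> ball 0 r. x $ k \<in> \<Omega>}"] exI[of _ "H ` \<Omega>"]) auto
qed

section \<open>Antiperiodic solutions of linear systems\<close>

text \<open>One more vector than the dimension must be dependent. The relation is indexed by
  position, so a repeated vector is treated separately, by the difference of its two
  occurrences.\<close>

lemma nontrivial_relation:
  fixes f :: "nat \<Rightarrow> 'a::euclidean_space"
  obtains m c where "\<exists>i<m. c i \<noteq> 0" "(\<Sum>i<m. c i *\<^sub>R f i) = 0"
proof -
  define m where "m = Suc DIM('a)"
  show thesis
  proof (cases "inj_on f {..<m}")
    case True
    then have "card (f ` {..<m}) = m" by (simp add: card_image)
    then have "dependent (f ` {..<m})"
      using independent_bound[of "f ` {..<m}"] by (auto simp: m_def)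
    then obtain u where "\<exists>v\<in>f ` {..<m}. u v \<noteq> 0" "(\<Sum>v\<in>f ` {..<m}. u v *\<^sub>R v) = 0"
      using dependent_finite[of "f ` {..<m}"] by auto
    then show thesis
      by (intro that[of m "u \<circ> f"]) (auto simp: sum.reindex[OF True])
  next
    case False
    then obtain i j where ij: "i < m" "j < m" "i \<noteq> j" "f i = f j"
      unfolding inj_on_def by blast
    define c where "c = (\<lambda>k. (if k = i then 1 else 0) - (if k = j then 1 else 0) :: real)"
    have "(\<Sum>k<m. c k *\<^sub>R f k) = f i - f j"
      using ij(1,2) unfolding c_def
      by (simp add: scaleR_left_diff_distrib sum_subtractf if_distrib[of "\<lambda>x. x *\<^sub>R _"] cong: if_cong)
    moreover have "c i \<noteq> 0" using ij(3) by (simp add: c_def)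
    ultimately show thesis using ij by (intro that[of m c]) auto
  qed
qed

text \<open>This is p(A) v, evaluated by Horner's scheme on vectors, without forming powers of
  \<open>A\<close>.\<close>

definition poly_act :: "complex ^ 'n ^ 'n \<Rightarrow> complex poly \<Rightarrow> complex ^ 'n \<Rightarrow> complex ^ 'n::finite" where
  "poly_act A p v = foldr (\<lambda>a w. a *s v + A *v w) (coeffs p) 0"

lemma poly_act_0 [simp]: "poly_act A 0 v = 0"
  by (simp add: poly_act_def)

lemma poly_act_pCons [simp]: "poly_act A (pCons a p) v = a *s v + A *v poly_act A p v"
  by (auto simp: poly_act_def cCons_def)

lemma poly_act_add: "poly_act A (p + q) v = poly_act A p v + poly_act A q v"
  by (induction p q rule: poly_induct2)
    (simp_all add: matrix_vector_right_distrib vector_sadd_rdistrib)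

lemma poly_act_smult: "poly_act A (smult c p) v = c *s poly_act A p v"
  by (induction p) (simp_all add: vector_add_ldistrib vector_smult_assoc matrix_vector_mult_smult)

text \<open>A - \<mu> commutes with q(A), so the factor may act on \<open>v\<close> first, the order
  used by \<open>factors_act\<close>.\<close>

lemma poly_act_linear_factor:
  "poly_act A ([:- \<mu>, 1:] * q) v = poly_act A q (A *v v - \<mu> *s v)"
proof -
  have "poly_act A q (A *v v - \<mu> *s v) = A *v poly_act A q v - \<mu> *s poly_act A q v"
  proof (induction q)
    case (pCons b q)
    show ?case
      unfolding poly_act_pCons pCons.IH
      by (simp add: matrix_vector_right_distrib matrix_vector_mult_diff_distrib
          matrix_vector_mult_smult algebra_simps)
  qed simp
  moreover have "poly_act A ([:- \<mu>, 1:] * q) v = A *v poly_act A q v - \<mu> *s poly_act A q v"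
    by (simp add: mult_pCons_left poly_act_add poly_act_smult flip: smult_minus_left)
  ultimately show ?thesis by simp
qed

text \<open>The product of the A - \<mu> over the list, head acting first. The recursion moves a
  factor into the argument, as the later induction on the list requires.\<close>

fun factors_act :: "complex ^ 'n ^ 'n \<Rightarrow> complex list \<Rightarrow> complex ^ 'n \<Rightarrow> complex ^ 'n::finite" where
  "factors_act A [] v = v"
| "factors_act A (\<mu> # \<mu>s) v = factors_act A \<mu>s (A *v v - \<mu> *s v)"

text \<open>Over the complex numbers \<open>p\<close> splits into linear factors. The nonzero
  leading constant is dropped, so only vanishing is transferred.\<close>

lemma factors_act_of_poly_act:
  assumes "p \<noteq> 0"
  shows "\<exists>\<mu>s. \<forall>v. poly_act A p v = 0 \<longrightarrow> factors_act A \<mu>s v = 0"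
  using assms
proof (induction "degree p" arbitrary: p)
  case 0
  then obtain a where "p = [:a:]" "a \<noteq> 0" by (metis degree_eq_zeroE pCons_eq_0_iff)
  then show ?case by (intro exI[of _ "[]"]) (auto simp: vec_eq_iff)
next
  case (Suc n)
  then have "\<not> constant (poly p)" by (simp add: constant_degree)
  then obtain \<mu> where "poly p \<mu> = 0" using fundamental_theorem_of_algebra by blast
  then obtain q where q: "p = [:- \<mu>, 1:] * q" unfolding poly_eq_0_iff_dvd dvd_def by blast
  with Suc.prems have "q \<noteq> 0" by auto
  then have "degree p = Suc (degree q)" unfolding q by (subst degree_mult_eq) auto
  with Suc.hyps(1)[of q] Suc.hyps(2) \<open>q \<noteq> 0\<close> obtain \<mu>s
    where "\<forall>v. poly_act A q v = 0 \<longrightarrow> factors_act A \<mu>s v = 0" by auto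
  then show ?case
    by (intro exI[of _ "\<mu> # \<mu>s"]) (simp only: q poly_act_linear_factor factors_act.simps, blast)
qed

text \<open>The powers of \<open>A\<close> lie in a finite-dimensional real space, so some
  nontrivial real combination of them vanishes. This is a nonzero polynomial annihilating
  \<open>A\<close>, which is then split into factors.\<close>

lemma annihilating_factors:
  fixes A :: "complex ^ 'n::finite ^ 'n"
  obtains \<mu>s where "\<And>v. factors_act A \<mu>s v = 0"
proof -
  define P where "P = (\<lambda>i. ((\<lambda>M. A ** M) ^^ i) (mat 1))"
  have P: "P i *v v = ((*v) A ^^ i) v" for i v
    by (induction i) (simp_all add: P_def matrix_vector_mul_assoc[symmetric])
  obtain m and c :: "nat \<Rightarrow> real" where c: "\<exists>i<m. c i \<noteq> 0" "(\<Sum>i<m. c i *\<^sub>R P i) = 0"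
    by (rule nontrivial_relation)
  define p where "p = (\<Sum>i<m. monom (complex_of_real (c i)) i)"
  obtain j where j: "j < m" "c j \<noteq> 0" using c(1) by blast
  then have "coeff p j \<noteq> 0" by (simp add: p_def coeff_sum)
  then have "p \<noteq> 0" by auto
  have monom: "poly_act A (monom a i) v = a *s ((*v) A ^^ i) v" for a i v
    by (induction i) (simp_all add: monom_0 monom_Suc matrix_vector_mult_smult)
  have "poly_act A p v = 0" for v
  proof -
    have "poly_act A p v = (\<Sum>i<m. poly_act A (monom (complex_of_real (c i)) i) v)"
      unfolding p_def by (induction m) (simp_all add: poly_act_add)
    also have "\<dots> = (\<Sum>i<m. (c i *\<^sub>R P i) *v v)"
    proof (rule sum.cong)
      fix i
      have "(c i *\<^sub>R P i) *v v = complex_of_real (c i) *s (P i *v v)"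
        unfolding vec_eq_iff matrix_vector_mult_def vector_scaleR_component vector_smult_component
          vec_lambda_beta by (simp add: scaleR_conv_of_real sum_distrib_left mult.assoc)
      then show "poly_act A (monom (complex_of_real (c i)) i) v = (c i *\<^sub>R P i) *v v"
        by (simp add: monom P)
    qed simp
    also have "\<dots> = (\<Sum>i<m. c i *\<^sub>R P i) *v v"
      by (induction m) (simp_all add: matrix_vector_mult_add_rdistrib)
    finally show ?thesis by (simp add: c(2))
  qed
  with factors_act_of_poly_act[OF \<open>p \<noteq> 0\<close>, of A] that show thesis by blast
qed

section \<open>A priori bounds for antiperiodic solutions\<close>

lemma has_vector_derivative_smult:
  fixes y :: "real \<Rightarrow> complex ^ 'n::finite"
  assumes "(c has_vector_derivative c') (at t)" "(y has_vector_derivative y') (at t)"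
  shows "((\<lambda>t. c t *s y t) has_vector_derivative c' *s y t + c t *s y') (at t)"
  unfolding has_vector_derivative_def has_derivative_vec_iff
proof
  fix i
  have "((\<lambda>t. y t $ i) has_vector_derivative y' $ i) (at t)"
    by (rule bounded_linear.has_vector_derivative[OF bounded_linear_vec_nth assms(2)])
  from has_vector_derivative_mult[OF assms(1) this]
  have "((\<lambda>t. c t * y t $ i) has_vector_derivative c t * y' $ i + c' * y t $ i) (at t)" .
  then show "((\<lambda>x. (c x *s y x) $ i) has_derivative (\<lambda>v. (v *\<^sub>R (c' *s y t + c t *s y')) $ i)) (at t)"
    by (simp add: has_vector_derivative_def add.commute)
qed

text \<open>With the integrating factor exp(-\<mu> (\<tau> - t)), only the forcing remains in the
  derivative. Over one antiperiod the product changes by -(exp(-\<mu> S) + 1) y(t), and that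
  coefficient is nonzero.\<close>

lemma antiperiodic_scalar_bound:
  fixes \<mu> :: complex and S :: real
  assumes "0 < S" "exp (\<mu> * of_real S) \<noteq> - 1"
  obtains C where "0 \<le> C" "\<And>(y :: real \<Rightarrow> complex ^ 'n::finite) g R t.
    (\<And>t. (y has_vector_derivative \<mu> *s y t + g t) (at t)) \<Longrightarrow> (\<And>t. norm (g t) \<le> R) \<Longrightarrow>
    (\<And>t. y (t + S) = - y t) \<Longrightarrow> norm (y t) \<le> C * R"
proof -
  define q where "q = exp (- \<mu> * of_real S) + 1"
  have q: "q \<noteq> 0"
  proof
    assume "q = 0"
    then have "exp (- \<mu> * of_real S) = - 1" by (simp add: q_def eq_neg_iff_add_eq_0)
    then have "inverse (exp (\<mu> * of_real S)) = - 1" by (simp add: exp_minus)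
    then have "exp (\<mu> * of_real S) = - 1" by (metis inverse_inverse_eq inverse_minus_eq inverse_1)
    then show False using assms(2) by simp
  qed
  \<comment> \<open>\<open>E\<close> bounds the integrating factor on an interval of length
    \<open>S\<close>, so the total change is at most S E R.\<close>
  define E where "E = exp (cmod \<mu> * S)"
  define C where "C = S * E / cmod q"
  have "0 \<le> C" using assms(1) by (simp add: C_def E_def)
  moreover have "norm (y t) \<le> C * R"
    if der: "\<And>t. (y has_vector_derivative \<mu> *s y t + g t) (at t)" and g: "\<And>t. norm (g t) \<le> R"
      and anti: "\<And>t. y (t + S) = - y t" for y :: "real \<Rightarrow> complex ^ 'n" and g R t
  proof -
    define c where "c = (\<lambda>\<tau>. exp (- \<mu> * of_real (\<tau> - t)))"
    define z where "z = (\<lambda>\<tau>. c \<tau> *s y \<tau>)"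
    have c': "(c has_vector_derivative - \<mu> * c \<tau>) (at \<tau>)" for \<tau>
    proof -
      have "((\<lambda>s. exp (- \<mu> * (s - of_real t))) has_field_derivative - \<mu> * c \<tau>) (at (of_real \<tau>))"
        unfolding c_def by (auto intro!: derivative_eq_intros)
      from has_vector_derivative_real_field[OF this] show ?thesis by (simp add: c_def)
    qed
    have z': "(z has_vector_derivative c \<tau> *s g \<tau>) (at \<tau>)" for \<tau>
    proof -
      have "(- \<mu> * c \<tau>) *s y \<tau> + c \<tau> *s (\<mu> *s y \<tau> + g \<tau>) = c \<tau> *s g \<tau>"
        by (simp add: vec_eq_iff algebra_simps)
      from has_vector_derivative_smult[OF c' der, of \<tau>, unfolded this] show ?thesis
        unfolding z_def .
    qed
    have "0 \<le> R" using g[of 0] norm_ge_zero order_trans by blast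
    have "norm (z (t + S) - z t) \<le> E * R * (t + S) - E * R * t"
    proof (rule differentiable_bound_general[where \<phi> = "\<lambda>\<tau>. E * R * \<tau>" and \<phi>' = "\<lambda>\<tau>. E * R"
          and f' = "\<lambda>\<tau>. c \<tau> *s g \<tau>"])
      show "t < t + S" using assms(1) by simp
      show "continuous_on {t..t + S} z"
        using has_vector_derivative_continuous[OF z'] by (intro continuous_at_imp_continuous_on) auto
      show "continuous_on {t..t + S} (\<lambda>\<tau>. E * R * \<tau>)" by (intro continuous_intros)
      fix \<tau> assume \<tau>: "t < \<tau>" "\<tau> < t + S"
      show "(z has_vector_derivative c \<tau> *s g \<tau>) (at \<tau>)" by (rule z')
      show "((\<lambda>\<tau>. E * R * \<tau>) has_vector_derivative E * R) (at \<tau>)"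
        unfolding has_real_derivative_iff_has_vector_derivative[symmetric]
        by (auto intro!: derivative_eq_intros)
      have "cmod (c \<tau>) \<le> exp (cmod (- \<mu> * of_real (\<tau> - t)))" unfolding c_def by (rule norm_exp)
      also have "\<dots> \<le> E"
        using \<tau> unfolding E_def by (simp add: norm_mult mult_left_mono flip: of_real_diff)
      finally show "norm (c \<tau> *s g \<tau>) \<le> E * R"
        unfolding norm_vector_smult_complex using g[of \<tau>] by (intro mult_mono) (auto simp: E_def)
    qed
    moreover have "z (t + S) - z t = - (q *s y t)"
      by (simp add: z_def c_def anti q_def vec_eq_iff distrib_right)
    ultimately have "cmod q * norm (y t) \<le> E * R * (t + S) - E * R * t"
      by (simp only: norm_minus_cancel norm_vector_smult_complex)
    then have "cmod q * norm (y t) \<le> S * E * R" by (simp add: algebra_simps)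
    then show ?thesis using q by (simp add: C_def field_simps)
  qed
  ultimately show thesis by (rule that)
qed

text \<open>Modulus 1 forces the real part to be 0, and \<mu> = 0 would give the value 1.\<close>

lemma exp_eq_minus_one_imaginary:
  assumes "exp (\<mu> * of_real S) = - 1" "0 < S"
  obtains \<omega> :: real where "\<omega> \<noteq> 0" "\<mu> = of_real \<omega> * \<i>"
proof
  have "exp (Re \<mu> * S) = 1" using arg_cong[OF assms(1), of cmod] by (simp add: norm_exp_eq_Re)
  then have "Re \<mu> = 0" using assms(2) by simp
  then show "\<mu> = of_real (Im \<mu>) * \<i>" by (simp add: complex_eq_iff)
  then show "Im \<mu> \<noteq> 0" using assms(1) by (intro notI) simp
qed

text \<open>The annihilating product is stripped off factor by factor; each factor \<open>A - \<mu>\<close> is either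
  invertible or leads to a scalar equation with invertible monodromy.\<close>

lemma antiperiodic_factors_bound:
  fixes A :: "complex ^ 'n::finite ^ 'n"
  assumes S: "0 < S" and noeig: "\<And>\<mu>. exp (\<mu> * of_real S) = - 1 \<Longrightarrow> \<not> matrix_eigenvalue A \<mu>"
  shows "\<exists>C\<ge>0. \<forall>u r R. (\<forall>t. (u has_vector_derivative A *v u t + r t) (at t)) \<longrightarrow>
    (\<forall>t. norm (r t) \<le> R) \<longrightarrow> (\<forall>t. u (t + S) = - u t) \<longrightarrow> (\<forall>t. factors_act A \<mu>s (u t) = 0) \<longrightarrow>
    (\<forall>t. norm (u t) \<le> C * R)"
proof (induction \<mu>s)
  case Nil
  then show ?case by (intro exI[of _ 0]) auto
next
  case (Cons \<mu> \<mu>s)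
  then obtain C0 where C0: "0 \<le> C0" and IH: "\<And>u r R t.
    (\<And>t. (u has_vector_derivative A *v u t + r t) (at t)) \<Longrightarrow> (\<And>t. norm (r t) \<le> R) \<Longrightarrow>
    (\<And>t. u (t + S) = - u t) \<Longrightarrow> (\<And>t. factors_act A \<mu>s (u t) = 0) \<Longrightarrow> norm (u t) \<le> C0 * R"
    by blast
  define L where "L = (\<lambda>x. A *v x - \<mu> *s x)"
  have blin: "bounded_linear L" unfolding L_def
    by (intro bounded_linear_sub bounded_linear_matrix_vector_mult
        bounded_linear_intro[where K = "cmod \<mu>"])
      (auto simp: norm_vector_smult_complex vec_eq_iff algebra_simps)
  define B where "B = onorm L"
  have B: "0 \<le> B" unfolding B_def by (rule onorm_pos_le[OF blin])
  \<comment> \<open>In either case bounds on \<open>L u\<close> and on the forcing bound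
    \<open>u\<close> itself.\<close>
  obtain b where b: "0 \<le> b" and inv: "\<And>u r R t.
    (\<And>t. (u has_vector_derivative A *v u t + r t) (at t)) \<Longrightarrow> (\<And>t. norm (r t) \<le> R) \<Longrightarrow>
    (\<And>t. u (t + S) = - u t) \<Longrightarrow> (\<And>t. norm (L (u t)) \<le> C0 * (B * R)) \<Longrightarrow>
    norm (u t) \<le> b * (C0 * (B * R) + R)"
  proof (cases "exp (\<mu> * of_real S) = - 1")
    case True
    \<comment> \<open>At a resonant exponent the scalar equation gives nothing, but \<mu> is not an
      eigenvalue, so \<open>L\<close> is injective and bounded below.\<close>
    have "L x = 0 \<longrightarrow> x = 0" for x
      using noeig[OF True] by (auto simp: matrix_eigenvalue_def L_def)
    then have "inj L" using linear_injective_0[OF bounded_linear.linear[OF blin]] by blast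
    then obtain b' where b': "0 < b'" "\<And>x. b' * norm x \<le> norm (L x)"
      using linear_inj_bounded_below_pos[OF bounded_linear.linear[OF blin]] by blast
    show thesis
    proof (rule that[of "1 / b'"])
      fix u r R t
      assume "\<And>t. norm (r t :: complex ^ 'n) \<le> R" "\<And>t. norm (L (u t)) \<le> C0 * (B * R)"
      then have "0 \<le> R" "norm (L (u t)) \<le> C0 * (B * R)" using norm_ge_zero order_trans by blast+
      then have "b' * norm (u t) \<le> C0 * (B * R) + R" using b'(2)[of "u t"] by linarith
      then show "norm (u t) \<le> 1 / b' * (C0 * (B * R) + R)" using b'(1) by (simp add: field_simps)
    qed (use b' in simp)
  next
    case False
    obtain C where C: "0 \<le> C" "\<And>(y :: real \<Rightarrow> complex ^ 'n::finite) g R t.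
      (\<And>t. (y has_vector_derivative \<mu> *s y t + g t) (at t)) \<Longrightarrow> (\<And>t. norm (g t) \<le> R) \<Longrightarrow>
      (\<And>t. y (t + S) = - y t) \<Longrightarrow> norm (y t) \<le> C * R"
      using antiperiodic_scalar_bound[OF S False, where ?'n = 'n] by blast
    show thesis
    proof (rule that[OF C(1)])
      fix u r R t
      assume u: "\<And>t. (u has_vector_derivative A *v u t + r t) (at t)" "\<And>t. norm (r t) \<le> R"
        "\<And>t. u (t + S) = - u t" "\<And>t. norm (L (u t)) \<le> C0 * (B * R)"
      show "norm (u t) \<le> C * (C0 * (B * R) + R)"
      \<comment> \<open>Rewriting A u as \<mu> u + L u makes \<open>L u\<close> part of the forcing
        of a scalar equation.\<close>
      proof (rule C(2)[where g = "\<lambda>t. L (u t) + r t"])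
        show "(u has_vector_derivative \<mu> *s u t + (L (u t) + r t)) (at t)" for t
          using u(1)[of t] by (simp add: L_def)
        show "norm (L (u t) + r t) \<le> C0 * (B * R) + R" for t
          using norm_triangle_ineq[of "L (u t)" "r t"] u(2)[of t] u(4)[of t] by linarith
      qed (rule u(3))
    qed
  qed
  have "norm (u t) \<le> (b * (C0 * B + 1)) * R"
    if u: "\<And>t. (u has_vector_derivative A *v u t + r t) (at t)" "\<And>t. norm (r t) \<le> R"
      "\<And>t. u (t + S) = - u t" "\<And>t. factors_act A (\<mu> # \<mu>s) (u t) = 0" for u r R t
  proof -
    have "norm (u t) \<le> b * (C0 * (B * R) + R)"
    proof (rule inv[OF u(1-3)])
      fix t
      show "norm (L (u t)) \<le> C0 * (B * R)"
      \<comment> \<open>\<open>L\<close> commutes with \<open>A\<close>, so \<open>L u\<close>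
        solves the same system with forcing \<open>L r\<close> and is annihilated by the remaining
        factors.\<close>
      proof (rule IH[where r = "\<lambda>t. L (r t)"])
        show "((\<lambda>t. L (u t)) has_vector_derivative A *v L (u t) + L (r t)) (at t)" for t
        proof -
          have "A *v L (u t) + L (r t) = L (A *v u t + r t)"
            by (simp add: L_def matrix_vector_right_distrib matrix_vector_mult_diff_distrib
                matrix_vector_mult_smult vector_add_ldistrib)
          then show ?thesis using bounded_linear.has_vector_derivative[OF blin u(1)] by simp
        qed
        show "norm (L (r t)) \<le> B * R" for t
          using onorm[OF blin, of "r t"] mult_left_mono[OF u(2) B] unfolding B_def by (rule order_trans)
        show "L (u (t + S)) = - L (u t)" for t
          using linear_neg[OF bounded_linear.linear[OF blin]] u(3) by simp
        show "factors_act A \<mu>s (L (u t)) = 0" for t using u(4)[of t] by (simp add: L_def)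
      qed
    qed
    then show ?thesis by (simp add: algebra_simps)
  qed
  moreover have "0 \<le> b * (C0 * B + 1)" using b C0 B by simp
  ultimately show ?case by blast
qed

text \<open>An annihilating product makes the last condition of
  \<open>antiperiodic_factors_bound\<close> automatic. Exponents with exp(\<mu> S) = -1 are nonzero
  imaginary, hence not eigenvalues.\<close>

lemma antiperiodic_bound:
  fixes A :: "complex ^ 'n::finite ^ 'n"
  assumes S: "0 < S" and noeig: "\<And>\<omega>::real. \<omega> \<noteq> 0 \<Longrightarrow> \<not> matrix_eigenvalue A (of_real \<omega> * \<i>)"
  obtains C where "0 \<le> C" "\<And>u r R t.
    (\<And>t. (u has_vector_derivative A *v u t + r t) (at t)) \<Longrightarrow> (\<And>t. norm (r t) \<le> R) \<Longrightarrow>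
    (\<And>t. u (t + S) = - u t) \<Longrightarrow> norm (u t) \<le> C * R"
proof -
  obtain \<mu>s where "\<And>v. factors_act A \<mu>s v = 0" using annihilating_factors[of A] by blast
  moreover have "\<not> matrix_eigenvalue A \<mu>" if "exp (\<mu> * of_real S) = - 1" for \<mu>
    using exp_eq_minus_one_imaginary[OF that S] noeig by metis
  note antiperiodic_factors_bound[OF S this, of \<mu>s]
  ultimately show thesis using that by (metis (no_types, lifting))
qed

text \<open>A Gronwall estimate. Since \<open>F\<close> is controlled only inside the ball of radius
  \<open>\<delta>\<close>, it is run up to the first exit time, where it contradicts the
  exit.\<close>

lemma small_orbit:
  fixes x :: "real \<Rightarrow> 'a::real_inner"
  assumes x': "\<And>t. (x has_vector_derivative F (x t)) (at t)" and "0 \<le> L"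
    and L: "\<And>y. norm y < \<delta> \<Longrightarrow> norm (F y) \<le> L * norm y"
    and x0: "norm (x 0) * exp (L * T) < \<delta>" and t: "0 \<le> t" "t \<le> T"
  shows "norm (x t) < \<delta>"
proof (rule ccontr)
  assume "\<not> norm (x t) < \<delta>"
  define Z where "Z = {s \<in> {0..T}. \<delta> \<le> norm (x s)}"
  have cont: "continuous_on X x" for X
    using has_vector_derivative_continuous[OF x'] by (intro continuous_at_imp_continuous_on) auto
  have "compact Z"
  proof -
    have "Z = {0..T} \<inter> (\<lambda>s. norm (x s)) -` {\<delta>..}" by (auto simp: Z_def)
    moreover have "closed ({0..T} \<inter> (\<lambda>s. norm (x s)) -` {\<delta>..})"
      by (intro continuous_closed_preimage continuous_on_norm cont) auto
    moreover have "bounded Z" by (rule bounded_subset[of "{0..T}"]) (auto simp: Z_def)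
    ultimately show ?thesis by (simp add: compact_eq_bounded_closed)
  qed
  moreover have "t \<in> Z" using t \<open>\<not> norm (x t) < \<delta>\<close> by (simp add: Z_def)
  ultimately obtain t1 where t1: "t1 \<in> Z" "\<And>s. s \<in> Z \<Longrightarrow> t1 \<le> s"
    using compact_attains_inf[of Z] by blast
  have small: "norm (x s) < \<delta>" if "0 \<le> s" "s < t1" for s
    using t1 that by (force simp: Z_def)
  \<comment> \<open>The squared norm is used because it stays differentiable where \<open>x\<close>
    vanishes; \<open>G\<close> is nonincreasing while the orbit is inside the ball.\<close>
  define G where "G = (\<lambda>s. exp (- 2 * L * s) * (x s \<bullet> x s))"
  have "G t1 \<le> G 0"
  proof (rule DERIV_nonpos_imp_decreasing_open[where f = G and a = 0 and b = t1])
    show "0 \<le> t1" using t1(1) by (simp add: Z_def)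
    show "continuous_on {0..t1} G" unfolding G_def by (intro continuous_intros cont)
    fix s assume s: "0 < s" "s < t1"
    have "((\<lambda>s. x s \<bullet> x s) has_vector_derivative x s \<bullet> F (x s) + F (x s) \<bullet> x s) (at s)"
      by (rule bounded_bilinear.has_vector_derivative[OF bounded_bilinear_inner x' x'])
    then have d: "((\<lambda>s. x s \<bullet> x s) has_real_derivative 2 * (x s \<bullet> F (x s))) (at s)"
      by (simp add: has_real_derivative_iff_has_vector_derivative inner_commute)
    have "(G has_real_derivative exp (- 2 * L * s) * (2 * (x s \<bullet> F (x s)) - 2 * L * (x s \<bullet> x s))) (at s)"
      unfolding G_def by (auto intro!: derivative_eq_intros d simp: algebra_simps)
    moreover have "x s \<bullet> F (x s) \<le> L * (x s \<bullet> x s)"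
    proof -
      have "x s \<bullet> F (x s) \<le> norm (x s) * norm (F (x s))" by (rule norm_cauchy_schwarz)
      also have "\<dots> \<le> norm (x s) * (L * norm (x s))"
        using L[OF small[of s]] s by (intro mult_left_mono) auto
      finally show ?thesis by (simp add: dot_square_norm power2_eq_square mult_ac)
    qed
    ultimately show "\<exists>y. (G has_real_derivative y) (at s) \<and> y \<le> 0"
      by (intro exI conjI) (auto intro!: mult_nonneg_nonpos)
  qed
  then have "(norm (x t1))\<^sup>2 \<le> (norm (x 0) * exp (L * t1))\<^sup>2"
    by (simp add: G_def dot_square_norm power_mult_distrib exp_double[symmetric] exp_minus field_simps
        flip: exp_add)
  then have "norm (x t1) \<le> norm (x 0) * exp (L * t1)" by (rule power2_le_imp_le) simp
  also have "\<dots> \<le> norm (x 0) * exp (L * T)"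
    using t1 \<open>0 \<le> L\<close> by (intro mult_left_mono) (auto simp: Z_def mult_left_mono)
  finally show False using x0 t1 by (simp add: Z_def)
qed

section \<open>Small periodic orbits\<close>

text \<open>An isolated point of \<open>A\<close> is a regular point of dimension \<open>0\<close> and of no other dimension.\<close>

lemma dim_at_isolated:
  fixes A :: "(complex ^ 'n::finite) set"
  assumes "0 < e" and A: "A \<inter> ball 0 e = {0}"
  shows "dim_at A 0 = 0"
proof -
  let ?D = "{d. \<forall>N. open N \<and> 0 \<in> N \<longrightarrow> (\<exists>z\<in>N. regular_point A d z)}"
  have "holomorphic_map (ball 0 e) (\<lambda>x :: complex ^ 'n. x)"
    unfolding holomorphic_map_def holomorphic_fun_def
    by (auto intro!: exI[of _ "\<lambda>v. v $ _"] bounded_linear_imp_has_derivative)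
  moreover have "homeomorphism (ball 0 e) (ball 0 e) (\<lambda>x :: complex ^ 'n. x) (\<lambda>x. x)"
    by (auto intro!: homeomorphismI)
  moreover have "(\<lambda>x. x) ` (A \<inter> ball 0 e) = {w \<in> ball 0 e. \<forall>i. i \<notin> {} \<longrightarrow> w $ i = 0}"
    unfolding A using \<open>0 < e\<close> by (auto simp: vec_eq_iff)
  moreover have "0 \<in> A" using A by blast
  ultimately have "regular_point A 0 0"
    unfolding regular_point_def using \<open>0 < e\<close>
    by (intro conjI exI[of _ "ball 0 e"] exI[of _ "\<lambda>x. x"] exI[of _ "{}"]) auto
  then have "0 \<in> ?D" by blast
  moreover have "d = 0" if "d \<in> ?D" for d
  proof -
    have "\<forall>N. open N \<and> 0 \<in> N \<longrightarrow> (\<exists>z\<in>N. regular_point A d z)"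
      using that by (rule CollectD)
    then have "\<exists>z\<in>ball 0 e. regular_point A d z" using \<open>0 < e\<close> by simp
    then obtain z where z: "z \<in> ball 0 e" "regular_point A d z" by blast
    obtain V W \<phi> \<psi> and I :: "'n set" where zA: "z \<in> A" and V: "open V" "z \<in> V" and W: "open W"
      and homeo: "homeomorphism V W \<phi> \<psi>" and "holomorphic_map V \<phi>" "holomorphic_map W \<psi>"
      and I: "card I = d" and img: "\<phi> ` (A \<inter> V) = {w \<in> W. \<forall>i. i \<notin> I \<longrightarrow> w $ i = 0}"
      by (rule regular_pointE[OF z(2)])
    have "z = 0" using zA z(1) A by blast
    then have \<phi>0: "\<phi> 0 \<in> {w \<in> W. \<forall>i. i \<notin> I \<longrightarrow> w $ i = 0}" using img zA V by blast
    have \<psi>0: "\<psi> (\<phi> 0) = 0" using homeomorphism_apply1[OF homeo] V \<open>z = 0\<close> by simp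
    have "I = {}"
    proof (rule ccontr)
      assume "I \<noteq> {}"
      then obtain i where i: "i \<in> I" by blast
      \<comment> \<open>A path in a free direction of the chart stays in the flattened set. Its
        pullback lies in \<open>A\<close> and tends to 0, so for small \<open>s\<close> it equals 0,
        against injectivity of the chart.\<close>
      define w where "w = (\<lambda>s::complex. \<phi> 0 + s *s axis i 1)"
      have w: "isCont w 0" unfolding w_def
        by (intro continuous_intros bounded_linear.isCont[OF bounded_linear_smult_left])
      have "w 0 \<in> W" using \<phi>0 by (simp add: w_def)
      have "isCont \<psi> (w 0)"
        using homeomorphism_cont2[OF homeo] W \<open>w 0 \<in> W\<close> by (simp add: continuous_on_eq_continuous_at)
      then have "isCont (\<lambda>s. \<psi> (w s)) 0" using isCont_o2[OF w] by blast
      then have "((\<lambda>s. \<psi> (w s)) \<longlongrightarrow> 0) (at 0)" by (simp add: isCont_def w_def \<psi>0)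
      then have "\<forall>\<^sub>F s in at 0. \<psi> (w s) \<in> ball 0 e"
        by (rule topological_tendstoD) (use \<open>0 < e\<close> in auto)
      moreover have "\<forall>\<^sub>F s in at 0. w s \<in> W"
        using w W \<open>w 0 \<in> W\<close> unfolding isCont_def by (intro topological_tendstoD)
      moreover have "\<forall>\<^sub>F s in at (0::complex). s \<noteq> 0" by (simp add: eventually_at_filter)
      ultimately have "\<forall>\<^sub>F s in at 0. \<psi> (w s) \<in> ball 0 e \<and> w s \<in> W \<and> s \<noteq> 0"
        by eventually_elim auto
      then obtain s where s: "\<psi> (w s) \<in> ball 0 e" "w s \<in> W" "s \<noteq> 0"
        using eventually_happens'[OF at_neq_bot] by blast
      have "w s \<in> \<phi> ` (A \<inter> V)"
        unfolding img using s(2) \<phi>0 i by (auto simp: w_def axis_def)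
      then obtain y where "y \<in> A" "y \<in> V" "w s = \<phi> y" by blast
      then have "\<psi> (w s) \<in> A" using homeomorphism_apply1[OF homeo] by simp
      with s(1) A have "\<psi> (w s) = 0" by blast
      then have "w s = \<phi> 0" using homeomorphism_apply2[OF homeo s(2)] by simp
      then have "(s *s axis i (1::complex)) $ i = 0" unfolding w_def by simp
      then show False using s(3) by (simp add: axis_def)
    qed
    then show "d = 0" using I by simp
  qed
  ultimately have "?D = {0}" by blast
  then show ?thesis unfolding dim_at_def by simp
qed

section \<open>Exclusion of small orbits of a given period\<close>

lemma small_periodic_solution_constant:
  fixes F :: "complex ^ 'n::finite \<Rightarrow> complex ^ 'n" and r T :: real
  assumes F: "holomorphic_map (ball 0 r) F" "0 < r" "F 0 = 0" and T: "0 < T"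
    and noeig: "\<And>\<omega>::real. \<omega> \<noteq> 0 \<Longrightarrow> \<not> matrix_eigenvalue (jacobian F (at 0)) (of_real \<omega> * \<i>)"
  obtains \<delta> where "0 < \<delta>" "\<forall>x. (\<forall>t. (x has_vector_derivative F (x t)) (at t)) \<longrightarrow>
    (\<forall>t. x (t + T) = x t) \<longrightarrow> norm (x 0) < \<delta> \<longrightarrow> (\<forall>t. x (t + T / 2) = x t)"
proof -
  define A where "A = jacobian F (at 0)"
  have "0 < T / 2" using T by simp
  then obtain C where C: "0 \<le> C" "\<And>u r R t.
    (\<And>t. (u has_vector_derivative A *v u t + r t) (at t)) \<Longrightarrow> (\<And>t. norm (r t) \<le> R) \<Longrightarrow>
    (\<And>t. u (t + T / 2) = - u t) \<Longrightarrow> norm (u t :: complex ^ 'n) \<le> C * R"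
    using antiperiodic_bound[of "T / 2" A] noeig unfolding A_def by blast
  \<comment> \<open>The a priori bound \<open>C\<close> times the relative size \<epsilon> of the
    forcing is at most 1/2; the added 1 covers \<open>C = 0\<close>.\<close>
  define \<epsilon> where "\<epsilon> = 1 / (2 * (C + 1))"
  have \<epsilon>: "0 < \<epsilon>" "C * \<epsilon> \<le> 1 / 2" using C(1) by (auto simp: \<epsilon>_def field_simps)
  obtain \<delta> where \<delta>: "0 < \<delta>" "\<delta> \<le> r" and strict: "\<And>x y. x \<in> ball 0 \<delta> \<Longrightarrow> y \<in> ball 0 \<delta> \<Longrightarrow>
      norm (F x - F y - A *v (x - y)) \<le> \<epsilon> * norm (x - y)"
    using holomorphic_map_strict_derivative[OF F \<epsilon>(1)] unfolding A_def by blast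
  define L where "L = onorm ((*v) A) + \<epsilon>"
  have "0 \<le> onorm ((*v) A)" by (rule onorm_pos_le[OF bounded_linear_matrix_vector_mult])
  then have L0: "0 \<le> L" using \<epsilon>(1) by (simp add: L_def)
  have L: "norm (F y) \<le> L * norm y" if "norm y < \<delta>" for y
    using strict[of y 0] that \<delta>(1) norm_matrix_vector_mult_le[of A y] norm_triangle_sub[of "F y" "A *v y"]
    by (simp add: L_def distrib_right F(3))
  show thesis
  \<comment> \<open>By \<open>small_orbit\<close>, starting within this radius keeps the orbit below
    \<open>\<delta>\<close> for a full period.\<close>
  proof (rule that[of "\<delta> * exp (- (L * T))"], goal_cases)
    case 1
    show ?case using \<delta>(1) by simp
  next
    case 2
    show ?case
    proof (intro allI impI)
      fix x t
      assume "\<forall>t. (x has_vector_derivative F (x t)) (at t)" and "\<forall>t. x (t + T) = x t"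
      then have x': "\<And>t. (x has_vector_derivative F (x t)) (at t)" and per: "\<And>t. x (t + T) = x t"
        by auto
      assume x0: "norm (x 0) < \<delta> * exp (- (L * T))"
      have small0: "norm (x t) < \<delta>" if "0 \<le> t" "t \<le> T" for t
        using that x0 by (intro small_orbit[OF x' L0 L]) (auto simp: exp_minus field_simps)
      have small: "norm (x t) < \<delta>" for t
      proof -
        \<comment> \<open>Periodicity in both time directions reduces every time to the interval
          from 0 to \<open>T\<close>.\<close>
        have up: "x (s + of_nat n * T) = x s" for s n
          using per[of "s + of_nat n * T" for n] by (induction n) (simp_all add: algebra_simps)
        have shift: "x (s + of_int k * T) = x s" for s k
        proof (cases "0 \<le> k")
          case True
          then show ?thesis using up[of s "nat k"] by simp
        next
          case False
          then show ?thesis using up[of "s + of_int k * T" "nat (- k)"] by simp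
        qed
        define k where "k = \<lfloor>t / T\<rfloor>"
        have "of_int k * T \<le> t" "t \<le> of_int k * T + T"
          using floor_divide_lower[OF T, of t] floor_divide_upper[OF T, of t]
          by (auto simp: k_def algebra_simps)
        then have "norm (x (t - of_int k * T)) < \<delta>" by (intro small0) auto
        then show ?thesis using shift[of "t - of_int k * T" k] by simp
      qed
      define u where "u = (\<lambda>t. x (t + T / 2) - x t)"
      define q where "q = (\<lambda>t. F (x (t + T / 2)) - F (x t) - A *v u t)"
      have u': "(u has_vector_derivative A *v u t + q t) (at t)" for t
      proof -
        have "((\<lambda>t. x (t + T / 2)) has_vector_derivative F (x (t + T / 2))) (at t)"
          using vector_diff_chain_at[of "\<lambda>t. t + T / 2" 1 t x] x'[of "t + T / 2"]
          by (simp add: o_def has_vector_derivative_add_const)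
        from has_vector_derivative_diff[OF this x'] show ?thesis by (simp add: u_def q_def)
      qed
      have q: "norm (q t) \<le> \<epsilon> * norm (u t)" for t
        unfolding q_def u_def using small by (intro strict) auto
      have anti: "u (t + T / 2) = - u t" for t
        using per[of t] by (simp add: u_def add.assoc)
      \<comment> \<open>The forcing is at most \<epsilon> |u|, so each uniform bound on
        \<open>u\<close> yields half of itself. Starting from 2 \<delta>, this forces
        \<open>u\<close> to vanish.\<close>
      have u_le: "norm (u t) \<le> 2 * \<delta> * (1 / 2) ^ n" for n t
      proof (induction n arbitrary: t)
        case 0
        then show ?case
          using small[of "t + T / 2"] small[of t] norm_triangle_ineq4[of "x (t + T / 2)" "x t"]
          by (simp add: u_def)
      next
        case (Suc n)
        have "norm (q t) \<le> \<epsilon> * (2 * \<delta> * (1 / 2) ^ n)" for t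
          using q[of t] mult_left_mono[OF Suc.IH[of t], of \<epsilon>] \<epsilon>(1) by linarith
        from C(2)[OF u' this anti] have "norm (u t) \<le> (C * \<epsilon>) * (2 * \<delta> * (1 / 2) ^ n)"
          by (simp add: mult.assoc)
        also have "\<dots> \<le> 1 / 2 * (2 * \<delta> * (1 / 2) ^ n)"
          using \<epsilon>(2) \<delta>(1) by (intro mult_right_mono) auto
        finally show ?case by simp
      qed
      have "(\<lambda>n. 2 * \<delta> * (1 / 2) ^ n) \<longlonglongrightarrow> 0"
        by (intro tendsto_mult_right_zero LIMSEQ_power_zero) simp
      then have "norm (u t) \<le> 0"
        by (rule LIMSEQ_le_const) (use u_le in auto)
      then show "x (t + T / 2) = x t" by (simp add: u_def)
    qed
  qed
qed

text \<open>Without an imaginary eigenvalue, every orbit of period \<open>T\<close> close enough to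
  0 also has period T/2. As all orbits share \<open>T\<close>, this radius can be fixed before an
  orbit is chosen, and positive dimension supplies one within it.\<close>

lemma imaginary_eigenvalue_of_isoperiodic_variety:
  fixes F :: "complex ^ 'n::finite \<Rightarrow> complex ^ 'n" and r :: real
  assumes F: "holomorphic_map (ball 0 r) F" "0 < r" "F 0 = 0"
    and dim: "pure_dimensional A d" "1 \<le> d"
    and orbits: "consists_of_zero_and_isoperiodic_orbits F (ball 0 r) A"
  shows "\<exists>\<omega>::real. \<omega> \<noteq> 0 \<and> matrix_eigenvalue (jacobian F (at 0)) (complex_of_real \<omega> * \<i>)"
proof (rule ccontr)
  assume "\<not> ?thesis"
  then have noeig: "\<And>\<omega>::real. \<omega> \<noteq> 0 \<Longrightarrow> \<not> matrix_eigenvalue (jacobian F (at 0)) (of_real \<omega> * \<i>)"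
    by blast
  obtain T \<C> where "0 \<in> A" and \<C>: "\<forall>C\<in>\<C>. periodic_orbit F (ball 0 r) T C" "A - {0} = \<Union>\<C>"
    using orbits unfolding consists_of_zero_and_isoperiodic_orbits_def by blast
  have near: "\<exists>a\<in>A. a \<noteq> 0 \<and> norm a < e" if "0 < e" for e
  proof (rule ccontr)
    assume "\<not> ?thesis"
    then have "A \<inter> ball 0 e = {0}" using \<open>0 \<in> A\<close> that by auto
    then have "dim_at A 0 = 0" by (rule dim_at_isolated[OF that])
    then show False using dim \<open>0 \<in> A\<close> unfolding pure_dimensional_def by auto
  qed
  have orbit: "\<exists>x t0. (\<forall>t. (x has_vector_derivative F (x t)) (at t)) \<and> least_period x T \<and> x t0 = a"
    if a: "a \<in> A" "a \<noteq> 0" for a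
  proof -
    obtain C where "C \<in> \<C>" "a \<in> C" using a \<C>(2) by blast
    then obtain x where "solution_on_line F (ball 0 r) x" "least_period x T" "C = range x"
      using \<C>(1) unfolding periodic_orbit_def by metis
    moreover from this \<open>a \<in> C\<close> obtain t0 where "x t0 = a" by blast
    ultimately show ?thesis unfolding solution_on_line_def by blast
  qed
  \<comment> \<open>Positivity of \<open>T\<close> is read off from an orbit, so a point of
    \<open>A\<close> other than 0 is needed first.\<close>
  obtain a where "a \<in> A" "a \<noteq> 0" using near[of 1] by auto
  then have T: "0 < T" using orbit unfolding least_period_def by blast
  obtain \<delta> where \<delta>: "0 < \<delta>" "\<forall>x. (\<forall>t. (x has_vector_derivative F (x t)) (at t)) \<longrightarrow>
    (\<forall>t. x (t + T) = x t) \<longrightarrow> norm (x 0) < \<delta> \<longrightarrow> (\<forall>t. x (t + T / 2) = x t)"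
    by (rule small_periodic_solution_constant[OF F T noeig])
  obtain b where b: "b \<in> A" "b \<noteq> 0" "norm b < \<delta>" using near[OF \<delta>(1)] by blast
  obtain x t0 where x': "\<And>t. (x has_vector_derivative F (x t)) (at t)" and lp: "least_period x T"
    and xt0: "x t0 = b"
    using orbit[OF b(1,2)] by blast
  have "x (t + T / 2) = x t" for t
  proof -
    \<comment> \<open>Time is shifted so that the orbit starts at the small point \<open>b\<close>;
      the half period is then shifted back to \<open>x\<close>.\<close>
    have "((\<lambda>t. x (t + t0)) has_vector_derivative F (x (t + t0))) (at t)" for t
      using vector_diff_chain_at[of "\<lambda>t. t + t0" 1 t x] x'[of "t + t0"]
      by (simp add: o_def has_vector_derivative_add_const)
    moreover have "x (t + T + t0) = x (t + t0)" for t
      using lp unfolding least_period_def by (metis add.assoc add.commute)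
    ultimately have "x (s + T / 2 + t0) = x (s + t0)" for s
      using \<delta>(2)[rule_format, of "\<lambda>t. x (t + t0)" s] xt0 b(3) by simp
    from this[of "t - t0"] show ?thesis by (simp add: algebra_simps)
  qed
  moreover have "0 < T / 2" "T / 2 < T" using T by auto
  ultimately show False using lp unfolding least_period_def by blast
qed

theorem theorem3:
  fixes F :: "complex ^ 'n::finite \<Rightarrow> complex ^ 'n" and r :: real
  assumes "0 < r"
    and "holomorphic_map (ball 0 r) F"
    and "0 isolated_in {x \<in> ball 0 r. F x = 0}"
  shows "(\<exists>U A d. open U \<and> 0 \<in> U \<and> U \<subseteq> ball 0 r \<and> analytic_subset U A \<and>
             pure_dimensional A d \<and> 1 \<le> d \<and>
             consists_of_zero_and_isoperiodic_orbits F (ball 0 r) A)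
         \<longleftrightarrow> (\<exists>\<omega>::real. \<omega> \<noteq> 0 \<and>
               matrix_eigenvalue (jacobian F (at 0)) (complex_of_real \<omega> * \<i>))"
proof -
  have "F 0 = 0" using assms(3) by (simp add: isolated_in_def)
  note F = assms(2,1) this
  show ?thesis
    \<comment> \<open>The variety constructed has dimension d = 1, so the condition
      \<open>1 \<le> d\<close> holds by reflexivity.\<close>
    using imaginary_eigenvalue_of_isoperiodic_variety[OF F]
      isoperiodic_variety_of_imaginary_eigenvalue[OF F]
    by (meson order_refl)
qed

end
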